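(* Let $k$ be a field of characteristic zero, let $A$ be a standard graded artinian level $k$-algebra of codimension $3$, socle degree $c$ and multiplicity $e$, and let $h=(1,3,h_2,\dots,h_{c-1},h_c)$ be its $h$-vector. Let $t,i,j,m$ be the integers attached to $h$ as defined in the context. Then: (i) If $A$ is compressed, then $\dfrac{t\cdot i\cdot (c+3)}{6}\le e\le \dfrac{m\cdot j\cdot (c+3)}{6}$. (ii) If $h_{c-1}=3$ and $h_c=2$, then $\dfrac{t\cdot i\cdot (c+3)}{6}\le e\le \dfrac{m\cdot j\cdot (c+3)}{6}$. (iii) If $h_2\le 4$, then $\dfrac{t\cdot i\cdot (c+3)}{6}\le e$. (iv) If $h_{c-1}\le h_c+1$, then $e\le \dfrac{m\cdot j\cdot (c+3)}{6}$.
   Context: Conventions. $k$ is a field of characteristic zero and $R=k[x_1,\dots,x_r]$ with all $x_i$ of degree $1$ (here $r=3$). An algebra is a quotient $A=R/I$ with $I$ a homogeneous ideal containing no nonzero form of degree $1$, and $A$ artinian. Its $h$-vector is $h(A)=(h_0,h_1,\dots,h_c)$, $h_i=\dim_k A_i$, where $c$ (the socle degree) is the last index with $A_c\ne 0$. The codimension of $A$ is $h_1=r$ and its multiplicity is $e=h_0+\dots+h_c=\dim_k A$. Level algebras. The socle of $A$ is $\mathrm{soc}(A)=\{a\in A : a\overline{m}=0\}$, $\overline m$ being the maximal homogeneous ideal of $A$; the socle-vector is $s(A)=(s_0=0,s_1,\dots,s_c)$, $s_i=\dim_k \mathrm{soc}(A)_i$. $A$ is level if $s(A)=(0,\dots,0,s_c)$.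 The invariants $t,i,j,m$. Set $h_n=0$ for $n<0$ and for $n>c$, and for every integer $n$ put $$f(n)=h_n-3h_{n-1}+3h_{n-2}-h_{n-3}.$$ Let $t$ be the initial degree of $I$ (the least degree in which $I$ is nonzero; equivalently the smallest integer with $f(t)<0$); let $i$ be the smallest positive integer such that $f(i)>0$; let $j$ be the largest integer such that $f(j)>0$; let $m$ be the largest integer lower than $c+3$ such that $f(m)<0$. Compressed algebras. Put $N(r,d)=\dim_k R_d=\binom{r-1+d}{d}$. Given a codimension $r$ and a socle-vector $s=(0,s_1,\dots,s_c)$, for $d=0,1,\dots,c$ let $$r_d=N(r,d)-N(r,0)s_d-N(r,1)s_{d+1}-\dots-N(r,c-d)s_c .$$ One has $r_0<0$, $r_c\ge 0$ and $r_{d+1}>r_d$ for every $d$; let $b$ be the unique index with $1\le b\le c$, $r_b\ge 0$ and $r_{b-1}<0$. Suppose $s_1=\dots=s_{b-1}=0$. An algebra of codimension $r$ and socle-vector $s$ is called compressed (with respect to $(r,s)$) if its $h$-vector is $(h_0,\dots,h_c)$ with $h_i=\min\{N(r,i)-r_i,\;N(r,i)\}$ for $i=0,\dots,c$. *)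

theory Defs
  imports
    "HOL-Library.Poly_Mapping"
    "HOL-Library.Numeral_Type"
    "HOL-Algebra.Algebra"
    "HOL-Algebra.Algebraic_Closure_Type"
begin

section \<open>Graded quotients of a polynomial ring\<close>

text \<open>
  The polynomial ring over \<open>'k\<close> in variables indexed by \<open>'n\<close>: finitely supported functions from
  monomials (exponent vectors) to coefficients, with the convolution product.
  The codimension \<open>r\<close> is \<open>CARD('n)\<close>.
\<close>

type_synonym ('n, 'k) mpoly = "('n \<Rightarrow>\<^sub>0 nat) \<Rightarrow>\<^sub>0 'k"

abbreviation poly_ring :: "('n, 'k::field) mpoly ring" where
  "poly_ring \<equiv> ring_of_type_algebra"

definition mon_degree :: "('n::finite \<Rightarrow>\<^sub>0 nat) \<Rightarrow> nat" where
  "mon_degree m = (\<Sum>x\<in>UNIV. Poly_Mapping.lookup m x)"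

text \<open>The forms of degree \<open>d\<close>, including \<open>0\<close>: the component \<open>R\<^sub>d\<close>.\<close>

definition forms :: "nat \<Rightarrow> ('n::finite, 'k::field) mpoly set" where
  "forms d = {p. \<forall>m \<in> Poly_Mapping.keys p. mon_degree m = d}"

definition homogeneous_ideal :: "('n::finite, 'k::field) mpoly set \<Rightarrow> bool" where
  "homogeneous_ideal I \<longleftrightarrow> (\<exists>F \<subseteq> (\<Union>d. forms d). I = Idl\<^bsub>poly_ring\<^esub> F)"

text \<open>
  The algebra \<open>A = R/I\<close> is represented by its ideal \<open>I\<close>.
  Its elements are the cosets of \<open>I\<close>; in particular the zero of \<open>A\<close> is the set \<open>I\<close> itself.
\<close>

definition algebra_ideal :: "('n::finite, 'k::field) mpoly set \<Rightarrow> bool" where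
  "algebra_ideal I \<longleftrightarrow> homogeneous_ideal I \<and> I \<inter> forms 1 = {0}"

definition quot_alg :: "('n::finite, 'k::field) mpoly set \<Rightarrow> ('n, 'k) mpoly set ring" where
  "quot_alg I = poly_ring Quot I"

definition residue_class :: "('n::finite, 'k::field) mpoly set \<Rightarrow> ('n, 'k) mpoly \<Rightarrow> ('n, 'k) mpoly set" where
  "residue_class I p = I +>\<^bsub>poly_ring\<^esub> p"

text \<open>The field \<open>k\<close> as a subfield of \<open>A\<close>.\<close>

definition scalars :: "('n::finite, 'k::field) mpoly set \<Rightarrow> ('n, 'k) mpoly set set" where
  "scalars I = residue_class I ` range (Poly_Mapping.single 0)"

definition dim_k :: "('n::finite, 'k::field) mpoly set \<Rightarrow> ('n, 'k) mpoly set set \<Rightarrow> nat" where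
  "dim_k I V = ring.dim (quot_alg I) (scalars I) V"

definition component :: "('n::finite, 'k::field) mpoly set \<Rightarrow> nat \<Rightarrow> ('n, 'k) mpoly set set" where
  "component I d = residue_class I ` forms d"

definition artinian_ring :: "('a, 'b) ring_scheme \<Rightarrow> bool" where
  "artinian_ring A \<longleftrightarrow> ring A \<and>
     (\<forall>J :: nat \<Rightarrow> 'a set. (\<forall>n. ideal (J n) A) \<and> (\<forall>n. J (Suc n) \<subseteq> J n)
        \<longrightarrow> (\<exists>N. \<forall>n\<ge>N. J n = J N))"

definition socle_degree :: "('n::finite, 'k::field) mpoly set \<Rightarrow> nat" where
  "socle_degree I = (GREATEST d. component I d \<noteq> {\<zero>\<^bsub>quot_alg I\<^esub>})"

definition h_vector :: "('n::finite, 'k::field) mpoly set \<Rightarrow> nat \<Rightarrow> nat" where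
  "h_vector I d = dim_k I (component I d)"

definition multiplicity_alg :: "('n::finite, 'k::field) mpoly set \<Rightarrow> nat" where
  "multiplicity_alg I = (\<Sum>d = 0..socle_degree I. h_vector I d)"


section \<open>Socle, level and compressed algebras\<close>

text \<open>The maximal homogeneous ideal of \<open>A\<close>: classes of polynomials without constant term.\<close>

definition max_hom_ideal :: "('n::finite, 'k::field) mpoly set \<Rightarrow> ('n, 'k) mpoly set set" where
  "max_hom_ideal I = residue_class I ` {p. Poly_Mapping.lookup p 0 = 0}"

definition socle :: "('n::finite, 'k::field) mpoly set \<Rightarrow> ('n, 'k) mpoly set set" where
  "socle I = {a \<in> carrier (quot_alg I).
     \<forall>b \<in> max_hom_ideal I. a \<otimes>\<^bsub>quot_alg I\<^esub> b = \<zero>\<^bsub>quot_alg I\<^esub>}"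

definition socle_vector :: "('n::finite, 'k::field) mpoly set \<Rightarrow> nat \<Rightarrow> nat" where
  "socle_vector I d = dim_k I (socle I \<inter> component I d)"

definition level :: "('n::finite, 'k::field) mpoly set \<Rightarrow> bool" where
  "level I \<longleftrightarrow> (\<forall>d < socle_degree I. socle_vector I d = 0)"

definition num_forms :: "nat \<Rightarrow> nat \<Rightarrow> nat" where
  "num_forms r d = (r - 1 + d) choose d"

text \<open>The integers \<open>r\<^sub>d\<close> attached to a codimension \<open>r\<close> and a socle-vector \<open>s = (s\<^sub>0, \<dots>, s\<^sub>c)\<close>.\<close>

definition compressed_r :: "nat \<Rightarrow> nat \<Rightarrow> (nat \<Rightarrow> nat) \<Rightarrow> nat \<Rightarrow> int" where
  "compressed_r r c s d =
     int (num_forms r d) - (\<Sum>l = 0..c - d. int (num_forms r l) * int (s (d + l)))"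

text \<open>
  The index \<open>b\<close> is unique because \<open>r\<^sub>d\<close> is strictly increasing in \<open>d\<close>;
  the vanishing of \<open>s\<^sub>1, \<dots>, s\<^bsub>b-1\<^esub>\<close> is part of the notion.
\<close>

definition compressed :: "('n::finite, 'k::field) mpoly set \<Rightarrow> bool" where
  "compressed I \<longleftrightarrow>
     (let r = CARD('n); c = socle_degree I; s = socle_vector I; \<rho> = compressed_r r c s in
       (\<exists>b. 1 \<le> b \<and> b \<le> c \<and> \<rho> b \<ge> 0 \<and> \<rho> (b - 1) < 0 \<and> (\<forall>d. 1 \<le> d \<and> d < b \<longrightarrow> s d = 0)) \<and>
       (\<forall>d \<le> c. int (h_vector I d) = min (int (num_forms r d) - \<rho> d) (int (num_forms r d))))"


section \<open>The integers $t$, $i$, $j$, $m$\<close>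

text \<open>The \<open>h\<close>-vector extended by zero to all integers; \<open>h_vector I n = 0\<close> for \<open>n > c\<close> anyway.\<close>

definition h_ext :: "('n::finite, 'k::field) mpoly set \<Rightarrow> int \<Rightarrow> int" where
  "h_ext I n = (if n < 0 \<or> n > int (socle_degree I) then 0 else int (h_vector I (nat n)))"

definition f_diff :: "('n::finite, 'k::field) mpoly set \<Rightarrow> int \<Rightarrow> int" where
  "f_diff I n = h_ext I n - 3 * h_ext I (n - 1) + 3 * h_ext I (n - 2) - h_ext I (n - 3)"

definition inv_t :: "('n::finite, 'k::field) mpoly set \<Rightarrow> nat" where
  "inv_t I = (LEAST d. I \<inter> forms d \<noteq> {0})"

text \<open>
  The integers below exist in codimension 3. Writing \<open>f\<close> for \<open>f_diff I\<close>, the generating function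
  of \<open>f\<close> is \<open>(1 - z)\<^sup>3\<close> times that of the \<open>h\<close>-vector, so \<open>f 0 = 1\<close>, \<open>f (inv_t I) < 0\<close> with
  \<open>inv_t I < c + 3\<close>, and the sum of all \<open>n * f n\<close> vanishes, which forces \<open>f n > 0\<close> for some \<open>n > 0\<close>.
  On \<open>int\<close>, \<open>LEAST\<close> and \<open>GREATEST\<close> are meaningful because \<open>f\<close> has finite support.
\<close>

definition inv_i :: "('n::finite, 'k::field) mpoly set \<Rightarrow> int" where
  "inv_i I = (LEAST n. n > 0 \<and> f_diff I n > 0)"

definition inv_j :: "('n::finite, 'k::field) mpoly set \<Rightarrow> int" where
  "inv_j I = (GREATEST n. f_diff I n > 0)"

definition inv_m :: "('n::finite, 'k::field) mpoly set \<Rightarrow> int" where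
  "inv_m I = (GREATEST n. n < int (socle_degree I) + 3 \<and> f_diff I n < 0)"

end

theory Submission
  imports Defs "HOL-Library.Product_Plus"
begin

text \<open>
  Let \<open>s = h\<^sub>c\<close>. In a compressed level algebra \<open>h\<^sub>d = min (N d) (s N (c - d))\<close> with
  \<open>N d = (d + 1) (d + 2) / 2\<close>, so \<open>f\<close> vanishes away from \<open>0\<close>, \<open>b\<close>, \<open>b + 1\<close>, \<open>b + 2\<close>, \<open>c + 3\<close>; the values of
  \<open>f\<close> there and the inequalities defining \<open>b\<close> give both bounds. If \<open>h\<^sub>2 \<le> 4\<close> then \<open>t = 2\<close> and
  \<open>i \<le> 6\<close>, and since the \<open>h\<close>-vector of a level algebra stays at least 2 before the socle degree, \<open>e\<close> is
  large enough. If \<open>h\<^bsub>c-1\<^esub> \<le> h\<^sub>c + 1\<close> then \<open>j = c + 2\<close>; either \<open>m = c + 1\<close> and the bound says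
  \<open>e \<le> dim R / R\<^bsub>>c\<^esub>\<close>, or \<open>h\<^bsub>c-2\<^esub> \<le> 3\<close> and \<open>m = c\<close> up to small cases. The algebraic input is
  that \<open>h\<^sub>d \<le> 2\<close> forces \<open>h\<^bsub>d+1\<^esub> \<le> h\<^sub>d\<close> for \<open>d \<ge> 2\<close>, that the pairing
  \<open>A\<^sub>1 \<times> A\<^bsub>c-1\<^esub> \<rightarrow> A\<^sub>c\<close> is nondegenerate, and that \<open>h\<^bsub>c-1\<^esub> = 3\<close>, \<open>h\<^sub>c = 2\<close> imply \<open>h\<^sub>2 \<le> 4\<close>.
\<close>

section \<open>Linear algebra in infinite-dimensional spaces\<close>

text \<open>\<open>f\<close> is the third difference of \<open>h\<close>, i.e. the coefficient
  sequence of (1 - z)^3 h(z), so it vanishes wherever \<open>h\<close> agrees with one quadratic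
  polynomial at four consecutive indices; this explains the few exceptional positions in the
  compressed case. Part (ii) follows from the other two: the values 3 and 2 satisfy the hypothesis
  of (iv), and h_2 \<le> 4 gives (iii). The growth control is much weaker than Macaulay's theorem.
  For h_d \<le> 2 it rests on a linear form l with A_d = l A_{d-1}, a property that passes on to
  A_{d+1}. Combined with 3 \<le> h_{c-1} h_c, which is what nondegeneracy of the pairing yields
  numerically, it keeps \<open>h\<close> from dropping to 1 before degree c. Two dimensions occur:
  the statement measures cosets over the subfield \<open>scalars I\<close>, while all arguments with
  bases and functionals take place inside R over k. Since R is infinite-dimensional, dimensions are
  compared only for subsets of finite spans; \<open>dim_k_eq\<close> is the passage between the
  two.\<close>

context vector_space
begin

lemma finite_basis_exists:
  assumes "finite T" "V \<subseteq> span T"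
  obtains B where "B \<subseteq> V" "finite B" "independent B" "V \<subseteq> span B" "card B = dim V"
proof -
  obtain B where B: "B \<subseteq> V" "independent B" "V \<subseteq> span B" "card B = dim V"
    using basis_exists by blast
  moreover have "finite B"
    using independent_span_bound[OF assms(1) B(2)] B(1) assms(2) by (metis order_trans)
  ultimately show ?thesis using that by blast
qed

lemma card_le_dim_if_independent:
  assumes "finite T" "V \<subseteq> span T" "independent B" "B \<subseteq> V"
  shows "finite B" "card B \<le> dim V"
proof -
  obtain C where C: "C \<subseteq> V" "finite C" "independent C" "V \<subseteq> span C" "card C = dim V"
    using finite_basis_exists[OF assms(1,2)] .
  show "finite B" "card B \<le> dim V"
    using independent_span_bound[OF C(2) assms(3)] assms(4) C(4,5) by (metis order_trans)+
qed

lemma subset_span_if_card_ge_dim: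
  assumes "finite T" "V \<subseteq> span T" "independent B" "B \<subseteq> V" "dim V \<le> card B"
  shows "V \<subseteq> span B"
proof
  fix v assume v: "v \<in> V"
  show "v \<in> span B"
  proof (rule ccontr)
    assume n: "v \<notin> span B"
    then have *: "independent (insert v B)" "v \<notin> B"
      using independent_insertI assms(3) span_base by auto
    have "insert v B \<subseteq> V" using v assms(4) by auto
    then have "card (insert v B) \<le> dim V" "finite B"
      using card_le_dim_if_independent[OF assms(1,2) *(1)] by auto
    then show False using assms(5) *(2) by simp
  qed
qed

lemma subset_zero_if_dim_eq_0:
  assumes "finite T" "V \<subseteq> span T" "dim V = 0"
  shows "V \<subseteq> {0}"
  using subset_span_if_card_ge_dim[OF assms(1,2), of "{}"] assms(3) independent_empty by simp

lemma dim_linear_image_le: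
  assumes "finite T" "V \<subseteq> span T" "Vector_Spaces.linear scale scale f" "W \<subseteq> f ` V"
  shows "dim W \<le> dim V"
proof -
  interpret f: Vector_Spaces.linear scale scale f by fact
  obtain B where B: "B \<subseteq> V" "finite B" "independent B" "V \<subseteq> span B" "card B = dim V"
    using finite_basis_exists[OF assms(1,2)] .
  have "W \<subseteq> span (f ` B)"
    using assms(4) B(4) f.span_image[of B] by blast
  then have "dim W \<le> card (f ` B)" using B(2) by (intro dim_le_card) auto
  also have "\<dots> \<le> card B" using card_image_le[OF B(2)] .
  finally show ?thesis using B(5) by simp
qed

text \<open>The coordinates refer to a basis of the whole space extending \<open>B\<close>, so they
  are linear everywhere; on \<open>span B\<close> they coincide with the coordinates for
  \<open>B\<close>, hence those indexed by \<open>B\<close> detect zero.\<close>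

lemma separating_functionals:
  assumes "independent B"
  obtains \<phi> where "\<And>b. Vector_Spaces.linear scale (*) (\<phi> b)"
    "\<And>b b'. b \<in> B \<Longrightarrow> b' \<in> B \<Longrightarrow> \<phi> b b' = (if b' = b then 1 else 0)"
    "\<And>v. v \<in> span B \<Longrightarrow> (\<And>b. b \<in> B \<Longrightarrow> \<phi> b v = 0) \<Longrightarrow> v = 0"
proof
  let ?E = "extend_basis B"
  have E: "independent ?E" "span ?E = UNIV" "B \<subseteq> ?E"
    using independent_extend_basis[OF assms] span_extend_basis[OF assms]
      extend_basis_superset[OF assms] by auto
  show "Vector_Spaces.linear scale (*) (\<lambda>v. representation ?E v b)" for b
    using linear_representation[OF E(1,2)] .
  show "representation ?E b' b = (if b' = b then 1 else 0)" if "b \<in> B" "b' \<in> B" for b b'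
    using representation_basis[OF E(1), of b'] E(3) that by auto
  fix v assume v: "v \<in> span B" "\<And>b. b \<in> B \<Longrightarrow> representation ?E v b = 0"
  have "representation ?E v = representation B v"
    using representation_extend[OF E(1) v(1) E(3)] .
  then have "representation B v b = 0" for b
    using v(2) representation_ne_zero by metis
  then have "representation B v = (\<lambda>_. 0)" by auto
  then show "v = 0"
    using sum_nonzero_representation_eq[OF assms v(1)] by simp
qed

text \<open>One step of Gaussian elimination: a pivot \<open>s\<close> on which the functional is
  nonzero is dropped, and the right multiple of it is subtracted from the other vectors. Counting
  independent vectors avoids the dimension of a kernel in an infinite-dimensional space.\<close>

lemma independent_in_kernel:
  assumes "finite S" "independent S" "Vector_Spaces.linear scale (*) \<phi>"
  obtains S' where "finite S'" "independent S'" "S' \<subseteq> span S" "card S \<le> card S' + 1"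
    "\<And>v. v \<in> span S' \<Longrightarrow> \<phi> v = 0"
proof (cases "\<forall>s\<in>S. \<phi> s = 0")
  case True
  interpret \<phi>: Vector_Spaces.linear scale "(*)" \<phi> by fact
  have "\<phi> v = 0" if "v \<in> span S" for v
    using that True \<phi>.eq_0_on_span by blast
  then show ?thesis using that[of S] assms span_superset by auto
next
  case False
  interpret \<phi>: Vector_Spaces.linear scale "(*)" \<phi> by fact
  from False obtain s where s: "s \<in> S" "\<phi> s \<noteq> 0" by blast
  define g where "g v = v - scale (\<phi> v / \<phi> s) s" for v
  define T where "T = S - {s}"
  have lin: "Vector_Spaces.linear scale scale g"
    unfolding Vector_Spaces.linear_iff g_def
    by (auto simp: vector_space_axioms \<phi>.add \<phi>.scale add_divide_distrib scale_left_distrib scale_right_diff_distrib)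
  interpret g: Vector_Spaces.linear scale scale g by fact
  have ind: "s \<notin> span T" "independent T"
    using s assms(2) independent_mono[OF assms(2), of "S - {s}"] unfolding T_def
    by (auto simp: dependent_def)
  have inj: "inj_on g (span T)"
  proof (rule g.inj_on_iff_eq_0[THEN iffD2, rule_format])
    show "subspace (span T)" by simp
    fix v assume v: "v \<in> span T" "g v = 0"
    then have "scale (\<phi> v / \<phi> s) s \<in> span T" by (simp add: g_def)
    moreover have "s = scale (inverse (\<phi> v / \<phi> s)) (scale (\<phi> v / \<phi> s) s)"
      if "\<phi> v / \<phi> s \<noteq> 0" using that by simp
    ultimately have "\<phi> v / \<phi> s = 0"
      using ind(1) span_scale by metis
    then show "v = 0" using v(2) s(2) by (simp add: g_def)
  qed
  show ?thesis
  proof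
    show "finite (g ` T)" using assms(1) T_def by simp
    show "independent (g ` T)" using g.independent_injective_image[OF ind(2) inj] .
    show "g ` T \<subseteq> span S"
      using s(1) T_def by (auto simp: g_def intro!: span_diff span_scale intro: span_base)
    have "card (g ` T) = card T"
      using inj span_superset by (metis card_image inj_on_subset)
    then show "card S \<le> card (g ` T) + 1" using s(1) assms(1) T_def by simp
    fix v assume "v \<in> span (g ` T)"
    moreover have "\<phi> w = 0" if "w \<in> g ` T" for w
      using that s(2) by (auto simp: g_def \<phi>.diff \<phi>.scale)
    ultimately show "\<phi> v = 0" using \<phi>.eq_0_on_span by blast
  qed
qed

text \<open>Each functional costs at most one dimension, so a nonzero common zero exists as soon as
  \<open>S\<close> has more elements than \<open>J\<close>.\<close>

lemma independent_in_common_kernel: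
  assumes "finite J" "finite S" "independent S" "\<And>j. j \<in> J \<Longrightarrow> Vector_Spaces.linear scale (*) (\<phi> j)"
  obtains S' where "finite S'" "independent S'" "S' \<subseteq> span S" "card S \<le> card S' + card J"
    "\<And>v j. v \<in> span S' \<Longrightarrow> j \<in> J \<Longrightarrow> \<phi> j v = 0"
proof -
  have "\<exists>S'. finite S' \<and> independent S' \<and> S' \<subseteq> span S \<and> card S \<le> card S' + card J
    \<and> (\<forall>v\<in>span S'. \<forall>j\<in>J. \<phi> j v = 0)"
    using assms(1,4)
  proof (induction J rule: finite_induct)
    case empty
    then show ?case using assms(2,3) span_superset by auto
  next
    case (insert i J)
    then obtain S' where S': "finite S'" "independent S'" "S' \<subseteq> span S" "card S \<le> card S' + card J"
      "\<forall>v\<in>span S'. \<forall>j\<in>J. \<phi> j v = 0" by auto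
    obtain S'' where S'': "finite S''" "independent S''" "S'' \<subseteq> span S'" "card S' \<le> card S'' + 1"
      "\<And>v. v \<in> span S'' \<Longrightarrow> \<phi> i v = 0"
      using independent_in_kernel[OF S'(1,2)] insert.prems by blast
    have *: "span S'' \<subseteq> span S'" "span S' \<subseteq> span S"
      using S''(3) S'(3) by (simp_all add: span_minimal)
    have "S'' \<subseteq> span S" "card S \<le> card S'' + card (insert i J)"
      "\<forall>v\<in>span S''. \<forall>j\<in>insert i J. \<phi> j v = 0"
      using S'(3-5) S''(3-5) * insert.hyps by auto
    with S'' show ?case by blast
  qed
  then show ?thesis using that by blast
qed

text \<open>A basis of \<open>U\<close> is extended to the whole space; the map kills the basis of
  \<open>U\<close> and fixes the added vectors.\<close>

lemma linear_projection_along: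
  assumes "subspace U"
  obtains p where "Vector_Spaces.linear scale scale p" "\<And>v. p v = 0 \<longleftrightarrow> v \<in> U" "\<And>v. p v - v \<in> U"
proof -
  have "vector_space_pair scale scale"
    by (intro vector_space_pair.intro vector_space_axioms)
  note extend = vector_space_pair.linear_independent_extend[OF this]
  obtain B where B: "B \<subseteq> U" "independent B" "U \<subseteq> span B" by (rule basis_exists[of U])
  let ?E = "extend_basis B"
  have E: "independent ?E" "span ?E = UNIV" "B \<subseteq> ?E"
    using independent_extend_basis[OF B(2)] span_extend_basis[OF B(2)]
      extend_basis_superset[OF B(2)] by auto
  obtain p where p: "Vector_Spaces.linear scale scale p" "\<And>x. x \<in> ?E \<Longrightarrow> p x = (if x \<in> B then 0 else x)"
    using extend[OF E(1), of "\<lambda>x. if x \<in> B then 0 else x"] by blast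
  interpret p: Vector_Spaces.linear scale scale p by fact
  have 0: "p v = 0" if "v \<in> U" for v
  proof (rule p.eq_0_on_span[of B])
    show "p x = 0" if "x \<in> B" for x using p(2)[of x] E(3) that by auto
    show "v \<in> span B" using that B(3) by blast
  qed
  have 1: "p v - v \<in> U" for v
  proof -
    have "v \<in> span ?E" using E(2) by simp
    then show ?thesis
    proof (induction rule: span_induct_alt)
      case base
      then show ?case using assms by (simp add: p.zero subspace_0)
    next
      case (step a x y)
      have "p x - x \<in> U"
        using p(2)[OF step.hyps] B(1) assms by (auto simp: subspace_0 subspace_neg)
      then have "scale a (p x - x) + (p y - y) \<in> U"
        using step.IH assms by (simp add: subspace_add subspace_scale)
      moreover have "p (scale a x + y) - (scale a x + y) = scale a (p x - x) + (p y - y)"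
        by (simp only: p.add p.scale scale_right_diff_distrib) (simp add: algebra_simps)
      ultimately show ?case by (simp only:)
    qed
  qed
  have "v \<in> U" if "p v = 0" for v
    using subspace_neg[OF assms 1[of v]] that by simp
  then show ?thesis using that[OF p(1)] 0 1 by blast
qed

end

section \<open>Forms\<close>

text \<open>Scalars act through constant polynomials, whose residue classes are exactly
  \<open>scalars I\<close>; this makes the later comparison of dimensions direct.\<close>

definition scale_poly :: "'k::field \<Rightarrow> ('n, 'k) mpoly \<Rightarrow> ('n, 'k) mpoly" where
  "scale_poly a p = Poly_Mapping.single 0 a * p"

global_interpretation mp: vector_space "scale_poly :: 'k::field \<Rightarrow> ('n, 'k) mpoly \<Rightarrow> ('n, 'k) mpoly"
  by unfold_locales
    (auto simp: scale_poly_def single_add distrib_left distrib_right mult_single simp flip: mult.assoc)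

lemma lookup_scale_poly [simp]:
  "Poly_Mapping.lookup (scale_poly a p) m = a * Poly_Mapping.lookup p m"
  by (simp add: scale_poly_def Poly_Mapping.map.rep_eq when_def flip: mult_map_scale_conv_mult)

lemma scale_poly_mult_left: "scale_poly a p * q = scale_poly a (p * q)"
  by (simp add: scale_poly_def mult.assoc)

lemma scale_poly_mult_right: "p * scale_poly a q = scale_poly a (p * q)"
  by (simp add: scale_poly_def mult.left_commute)

lemma linear_mult: "Vector_Spaces.linear scale_poly scale_poly ((*) (q :: ('n, 'k::field) mpoly))"
  by unfold_locales (simp_all add: distrib_left scale_poly_mult_right)

lemma mon_degree_add: "mon_degree (m + n) = mon_degree m + mon_degree n"
  by (simp add: mon_degree_def lookup_add sum.distrib)

lemma mon_degree_single [simp]: "mon_degree (Poly_Mapping.single x n) = n"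
  by (simp add: mon_degree_def lookup_single when_def)

lemma mon_degree_0 [simp]: "mon_degree 0 = 0"
  by (simp add: mon_degree_def)

lemma mon_degree_eq_0D: "mon_degree m = 0 \<Longrightarrow> m = 0"
  by (rule poly_mapping_eqI) (simp add: mon_degree_def)

lemma mon_degree_SucE:
  assumes "mon_degree m = Suc d"
  obtains x n where "m = Poly_Mapping.single x 1 + n" "mon_degree n = d"
proof -
  obtain x where x: "Poly_Mapping.lookup m x > 0"
    using assms by (fastforce simp: mon_degree_def)
  define n where "n = m - Poly_Mapping.single x 1"
  have m: "m = Poly_Mapping.single x 1 + n"
    using x by (auto simp: n_def poly_mapping_eq_iff fun_eq_iff lookup_add lookup_minus lookup_single when_def)
  then have "mon_degree n = d"
    using assms by (simp add: mon_degree_add)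
  then show ?thesis using that m by blast
qed

lemma finite_monomials_of_degree: "finite {m :: 'n::finite \<Rightarrow>\<^sub>0 nat. mon_degree m = d}"
proof -
  have "Poly_Mapping.lookup m x \<le> mon_degree m" for m :: "'n \<Rightarrow>\<^sub>0 nat" and x
    unfolding mon_degree_def by (rule member_le_sum) auto
  then have "Poly_Mapping.lookup ` {m :: 'n \<Rightarrow>\<^sub>0 nat. mon_degree m = d} \<subseteq> PiE UNIV (\<lambda>_. {..d})"
    by auto
  moreover have "finite (PiE (UNIV :: 'n set) (\<lambda>_. {..d}))"
    by (rule finite_PiE) auto
  ultimately show ?thesis
    by (meson finite_subset finite_imageD inj_onI lookup_inject)
qed

lemma subspace_forms: "mp.subspace (forms d :: ('n::finite, 'k::field) mpoly set)"
  unfolding mp.subspace_def forms_def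
  by (auto simp: in_keys_iff lookup_add)

lemmas forms_0 [simp] = mp.subspace_0[OF subspace_forms]
  and forms_add = mp.subspace_add[OF subspace_forms]
  and forms_diff = mp.subspace_diff[OF subspace_forms]
  and forms_scale = mp.subspace_scale[OF subspace_forms]

lemma forms_single: "mon_degree m = d \<Longrightarrow> Poly_Mapping.single m a \<in> forms d"
  by (simp add: forms_def)

lemma one_in_forms_0: "1 \<in> forms 0"
  by (simp add: forms_def)

lemma forms_mult: "p \<in> forms a \<Longrightarrow> q \<in> forms b \<Longrightarrow> p * q \<in> forms (a + b)"
  using keys_mult[of p q] by (fastforce simp: forms_def mon_degree_add)

definition var :: "'n \<Rightarrow> ('n, 'k::field) mpoly" where
  "var x = Poly_Mapping.single (Poly_Mapping.single x 1) 1"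

lemma var_in_forms: "var x \<in> forms 1"
  by (simp add: forms_single var_def)

lemma poly_eq_sum_singles: "p = (\<Sum>m\<in>Poly_Mapping.keys p. Poly_Mapping.single m (Poly_Mapping.lookup p m))"
  by (rule poly_mapping_eqI) (auto simp: lookup_sum lookup_single when_def in_keys_iff)

lemma single_eq_scale_poly: "Poly_Mapping.single m a = scale_poly a (Poly_Mapping.single m 1)"
  by (simp add: scale_poly_def mult_single)

text \<open>Every monomial of positive degree is divisible by a variable. Its coefficient stays in
  the cofactor \<open>q\<close>, so no separate case for scalars arises.\<close>

lemma forms_Suc_induct [consumes 1, case_names zero add var_mult]:
  assumes "p \<in> forms (Suc d)"
    and "P 0" "\<And>p q. P p \<Longrightarrow> P q \<Longrightarrow> P (p + q)"
    and "\<And>x q. q \<in> forms d \<Longrightarrow> P (var x * q)"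
  shows "P p"
proof -
  have *: "P (Poly_Mapping.single m (Poly_Mapping.lookup p m))" if m: "m \<in> Poly_Mapping.keys p" for m
  proof -
    have "mon_degree m = Suc d" using assms(1) m by (auto simp: forms_def)
    then obtain x n where "m = Poly_Mapping.single x 1 + n" "mon_degree n = d"
      using mon_degree_SucE by blast
    then have "Poly_Mapping.single m (Poly_Mapping.lookup p m)
        = var x * Poly_Mapping.single n (Poly_Mapping.lookup p m)"
      "Poly_Mapping.single n (Poly_Mapping.lookup p m) \<in> forms d"
      by (simp_all add: mult_single forms_single var_def)
    then show ?thesis using assms(4) by metis
  qed
  have "P (\<Sum>m\<in>A. Poly_Mapping.single m (Poly_Mapping.lookup p m))"
    if "A \<subseteq> Poly_Mapping.keys p" for A
  proof -
    have "finite A" using finite_subset[OF that finite_keys] .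
    then show ?thesis using that *
      by (induction A rule: finite_induct) (auto intro: assms)
  qed
  then show ?thesis using poly_eq_sum_singles[of p] by (metis order_refl)
qed

lemma single_one_eq_iff: "Poly_Mapping.single m (1 :: 'k::field) = Poly_Mapping.single n 1 \<longleftrightarrow> m = n"
  by (metis lookup_single_eq lookup_single_not_eq zero_neq_one)

definition monomials :: "nat \<Rightarrow> ('n::finite, 'k::field) mpoly set" where
  "monomials d = (\<lambda>m. Poly_Mapping.single m 1) ` {m. mon_degree m = d}"

lemma finite_monomials [simp]: "finite (monomials d)"
  by (simp add: monomials_def finite_monomials_of_degree)

lemma monomials_subset: "monomials d \<subseteq> forms d"
  by (auto simp: monomials_def forms_single)

lemma forms_subset_span_monomials: "forms d \<subseteq> mp.span (monomials d)"
proof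
  fix p :: "('n::finite, 'k::field) mpoly" assume p: "p \<in> forms d"
  have "Poly_Mapping.single m (Poly_Mapping.lookup p m) \<in> mp.span (monomials d)"
    if "m \<in> Poly_Mapping.keys p" for m
    using p that unfolding single_eq_scale_poly[of m "Poly_Mapping.lookup p m"]
    by (intro mp.span_scale mp.span_base) (auto simp: monomials_def forms_def)
  then show "p \<in> mp.span (monomials d)"
    by (subst poly_eq_sum_singles) (rule mp.span_sum)
qed

lemma independent_singles:
  "mp.independent ((\<lambda>m. Poly_Mapping.single m 1) ` M :: ('n, 'k::field) mpoly set)"
proof
  let ?S = "(\<lambda>m. Poly_Mapping.single m 1) ` M :: ('n, 'k) mpoly set"
  assume "mp.dependent ?S"
  then obtain m where m: "Poly_Mapping.single m 1 \<in> mp.span (?S - {Poly_Mapping.single m 1})"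
    unfolding mp.dependent_def by blast
  have "mp.subspace {p :: ('n, 'k) mpoly. Poly_Mapping.lookup p m = 0}"
    by (simp add: mp.subspace_def lookup_add)
  moreover have "?S - {Poly_Mapping.single m 1} \<subseteq> {p. Poly_Mapping.lookup p m = 0}"
    by (auto simp: lookup_single when_def)
  ultimately have "Poly_Mapping.single m 1 \<in> {p :: ('n, 'k) mpoly. Poly_Mapping.lookup p m = 0}"
    using m mp.span_minimal by blast
  then show False by simp
qed

lemma dim_forms: "mp.dim (forms d :: ('n::finite, 'k::field) mpoly set)
    = card {m :: 'n \<Rightarrow>\<^sub>0 nat. mon_degree m = d}"
proof -
  have "mp.dim (forms d :: ('n, 'k) mpoly set) = card (monomials d :: ('n, 'k) mpoly set)"
    by (rule mp.dim_unique[OF monomials_subset forms_subset_span_monomials])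
      (simp_all add: monomials_def independent_singles)
  also have "\<dots> = card {m :: 'n \<Rightarrow>\<^sub>0 nat. mon_degree m = d}"
    unfolding monomials_def by (rule card_image, rule inj_onI) (simp only: single_one_eq_iff)
  finally show ?thesis .
qed

definition hom_comp :: "nat \<Rightarrow> ('n::finite, 'k::field) mpoly \<Rightarrow> ('n, 'k) mpoly" where
  "hom_comp d p = Poly_Mapping.mapp (\<lambda>m a. if mon_degree m = d then a else 0) p"

lemma lookup_hom_comp [simp]:
  "Poly_Mapping.lookup (hom_comp d p) m = (if mon_degree m = d then Poly_Mapping.lookup p m else 0)"
  by (auto simp: hom_comp_def lookup_mapp when_def in_keys_iff)

lemma hom_comp_in_forms: "hom_comp d p \<in> forms d"
  by (auto simp: forms_def in_keys_iff split: if_splits)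

lemma hom_comp_0 [simp]: "hom_comp d 0 = 0"
  by (rule poly_mapping_eqI) simp

lemma hom_comp_add: "hom_comp d (p + q) = hom_comp d p + hom_comp d q"
  by (rule poly_mapping_eqI) (simp add: lookup_add)

lemma hom_comp_sum: "hom_comp d (\<Sum>x\<in>A. f x) = (\<Sum>x\<in>A. hom_comp d (f x))"
  by (rule poly_mapping_eqI) (simp add: lookup_sum sum.If_cases)

lemma hom_comp_form: "p \<in> forms e \<Longrightarrow> hom_comp d p = (if d = e then p else 0)"
  by (rule poly_mapping_eqI) (auto simp: forms_def in_keys_iff)

lemma sum_hom_comp: "p = (\<Sum>d\<in>mon_degree ` Poly_Mapping.keys p. hom_comp d p)"
  by (rule poly_mapping_eqI) (auto simp: lookup_sum in_keys_iff)

lemma UNIV_3: "(UNIV :: 3 set) = {0, 1, 2}"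
proof -
  have "card {0, 1, 2 :: 3} = 3" by simp
  then have "{0, 1, 2 :: 3} = UNIV"
    by (intro card_subset_eq) auto
  then show ?thesis ..
qed

lemma sum_UNIV_3: "(\<Sum>x\<in>UNIV. f x) = f 0 + f 1 + f (2 :: 3)"
  unfolding UNIV_3 by (simp add: add.assoc)

lemma card_monomials_3: "card {m :: 3 \<Rightarrow>\<^sub>0 nat. mon_degree m = d} = (2 + d) choose d"
proof -
  let ?g = "\<lambda>m :: 3 \<Rightarrow>\<^sub>0 nat. (Poly_Mapping.lookup m 0, Poly_Mapping.lookup m 1)"
  have deg: "mon_degree m = Poly_Mapping.lookup m 0 + Poly_Mapping.lookup m 1 + Poly_Mapping.lookup m 2"
    for m :: "3 \<Rightarrow>\<^sub>0 nat"
    by (simp add: mon_degree_def sum_UNIV_3)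
  \<comment> \<open>The third exponent is determined by the other two, so the monomials correspond
    to the lattice points of a triangle.\<close>
  have "bij_betw ?g {m. mon_degree m = d} (SIGMA a:{..d}. {..d - a})"
  proof (rule bij_betw_imageI)
    show "inj_on ?g {m. mon_degree m = d}"
    proof (rule inj_onI)
      fix m n :: "3 \<Rightarrow>\<^sub>0 nat"
      assume *: "m \<in> {m. mon_degree m = d}" "n \<in> {m. mon_degree m = d}" "?g m = ?g n"
      have "Poly_Mapping.lookup m x = Poly_Mapping.lookup n x" for x
        using UNIV_I[of x] * unfolding UNIV_3 by (auto simp: deg)
      then show "m = n" by (rule poly_mapping_eqI)
    qed
    show "?g ` {m. mon_degree m = d} = (SIGMA a:{..d}. {..d - a})"
    proof (rule subset_antisym; rule subsetI)
      fix ab assume "ab \<in> ?g ` {m. mon_degree m = d}"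
      then show "ab \<in> (SIGMA a:{..d}. {..d - a})" by (auto simp: deg)
    next
      fix ab assume "ab \<in> (SIGMA a:{..d}. {..d - a})"
      then obtain a b where ab: "ab = (a, b)" "a \<le> d" "b \<le> d - a" by auto
      define m :: "3 \<Rightarrow>\<^sub>0 nat" where "m = Poly_Mapping.single 0 a + Poly_Mapping.single 1 b
        + Poly_Mapping.single 2 (d - a - b)"
      have "mon_degree m = d" "?g m = ab"
        using ab by (simp_all add: m_def mon_degree_add lookup_add lookup_single)
      then show "ab \<in> ?g ` {m. mon_degree m = d}" by (metis (mono_tags) image_eqI mem_Collect_eq)
    qed
  qed
  then have "card {m :: 3 \<Rightarrow>\<^sub>0 nat. mon_degree m = d} = card (SIGMA a:{..d}. {..d - a})"
    by (rule bij_betw_same_card)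
  also have "\<dots> = (\<Sum>a\<le>d. Suc (d - a))" by (subst card_SigmaI) auto
  also have "\<dots> = (\<Sum>a\<le>d. Suc a)"
    by (rule sum.reindex_bij_witness[of _ "\<lambda>a. d - a" "\<lambda>a. d - a"]) auto
  also have "\<dots> = (2 + d) choose 2"
  proof (induction d)
    case (Suc d)
    have "(2 + Suc d) choose 2 = ((2 + d) choose 1) + ((2 + d) choose 2)"
      using binomial_Suc_Suc[of "2 + d" 1] unfolding numeral_2_eq_2 by (simp only: add_Suc_right One_nat_def)
    with Suc show ?case by simp
  qed simp
  also have "\<dots> = (2 + d) choose d"
    by (subst binomial_symmetric) auto
  finally show ?thesis .
qed

section \<open>The Hilbert function of a graded ideal\<close>

text \<open>Closure under homogeneous components is the intrinsic form of homogeneity; generation by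
  forms implies it, see \<open>graded_ideal_if_homogeneous\<close>.\<close>

locale graded_ideal =
  fixes I :: "('n::finite, 'k::field) mpoly set"
  assumes zero_mem: "0 \<in> I"
    and add_mem: "p \<in> I \<Longrightarrow> q \<in> I \<Longrightarrow> p + q \<in> I"
    and mult_mem: "p \<in> I \<Longrightarrow> q * p \<in> I"
    and hom_comp_mem: "p \<in> I \<Longrightarrow> hom_comp d p \<in> I"
begin

lemma subspace_ideal: "mp.subspace I"
  by (simp add: mp.subspace_def zero_mem add_mem scale_poly_def mult_mem)

lemmas neg_mem = mp.subspace_neg[OF subspace_ideal]
  and scale_mem = mp.subspace_scale[OF subspace_ideal]

text \<open>
  A linear projection with kernel \<open>I\<close> models the quotient: \<open>A\<^sub>d\<close> becomes the subspace
  \<open>proj ` forms d\<close> of the polynomial ring, and multiplication by \<open>q\<close> becomes \<open>v \<mapsto> proj (q * v)\<close>.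
\<close>

definition proj :: "('n, 'k) mpoly \<Rightarrow> ('n, 'k) mpoly" where
  "proj = (SOME f. Vector_Spaces.linear scale_poly scale_poly f
     \<and> (\<forall>v. f v = 0 \<longleftrightarrow> v \<in> I) \<and> (\<forall>v. f v - v \<in> I))"

lemma
  shows linear_proj: "Vector_Spaces.linear scale_poly scale_poly proj"
    and proj_eq_0_iff: "proj v = 0 \<longleftrightarrow> v \<in> I"
    and proj_diff_mem: "proj v - v \<in> I"
proof -
  have "\<exists>f. Vector_Spaces.linear scale_poly scale_poly f
     \<and> (\<forall>v. f v = 0 \<longleftrightarrow> v \<in> I) \<and> (\<forall>v. f v - v \<in> I)"
    using mp.linear_projection_along[OF subspace_ideal] by metis
  then have "Vector_Spaces.linear scale_poly scale_poly proj
     \<and> (\<forall>v. proj v = 0 \<longleftrightarrow> v \<in> I) \<and> (\<forall>v. proj v - v \<in> I)"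
    unfolding proj_def by (rule someI_ex)
  then show "Vector_Spaces.linear scale_poly scale_poly proj"
    "proj v = 0 \<longleftrightarrow> v \<in> I" "proj v - v \<in> I" by auto
qed

sublocale proj: Vector_Spaces.linear scale_poly scale_poly proj
  by (rule linear_proj)

lemma proj_eq_iff: "proj p = proj q \<longleftrightarrow> p - q \<in> I"
  by (metis proj.diff proj_eq_0_iff right_minus_eq)

text \<open>Multiplication is well defined on the model of the quotient: passing to the
  representative \<open>proj p\<close> changes the product by an element of
  \<open>I\<close>.\<close>

lemma proj_mult_proj: "proj (q * proj p) = proj (q * p)"
  unfolding proj_eq_iff using mult_mem[OF proj_diff_mem, of q p] by (simp add: right_diff_distrib)

definition piece :: "nat \<Rightarrow> ('n, 'k) mpoly set" where
  "piece d = proj ` forms d"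

definition hilb :: "nat \<Rightarrow> nat" where
  "hilb d = mp.dim (piece d)"

lemma proj_in_piece: "p \<in> forms d \<Longrightarrow> proj p \<in> piece d"
  by (simp add: piece_def)

lemma piece_subset_span: "piece d \<subseteq> mp.span (proj ` monomials d)"
  using forms_subset_span_monomials[of d] unfolding piece_def proj.span_image by blast

lemmas finite_piece = finite_imageI[OF finite_monomials, of proj] piece_subset_span

lemma piece_mult:
  assumes "v \<in> piece d" "q \<in> forms e"
  shows "proj (q * v) \<in> piece (e + d)"
  using assms forms_mult[OF assms(2)] by (auto simp: piece_def proj_mult_proj)

lemma hilb_le: "hilb d \<le> mp.dim (forms d :: ('n, 'k) mpoly set)"
  unfolding hilb_def piece_def
  using mp.dim_linear_image_le[OF finite_monomials forms_subset_span_monomials linear_proj] by blast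

lemma hilb_eq_0_iff: "hilb d = 0 \<longleftrightarrow> forms d \<subseteq> I"
proof
  assume "hilb d = 0"
  then have "piece d \<subseteq> {0}"
    unfolding hilb_def by (rule mp.subset_zero_if_dim_eq_0[OF finite_piece])
  then show "forms d \<subseteq> I" by (auto simp: piece_def proj_eq_0_iff)
next
  assume "forms d \<subseteq> I"
  then have "piece d \<subseteq> mp.span {}" by (auto simp: piece_def proj_eq_0_iff)
  then have "hilb d \<le> card ({} :: ('n, 'k) mpoly set)"
    unfolding hilb_def by (rule mp.dim_le_card) simp
  then show "hilb d = 0" by simp
qed

text \<open>Extend \<open>B\<close> to a basis \<open>E\<close> of the forms; \<open>proj\<close>
  kills \<open>B\<close>, so the images of \<open>E - B\<close> already span the piece.\<close>

lemma hilb_add_card_le: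
  assumes "mp.independent B" "B \<subseteq> I \<inter> forms d"
  shows "hilb d + card B \<le> mp.dim (forms d :: ('n, 'k) mpoly set)"
proof -
  obtain E where E: "B \<subseteq> E" "E \<subseteq> forms d" "mp.independent E" "forms d \<subseteq> mp.span E"
    using mp.maximal_independent_subset_extend[of B "forms d"] assms by auto
  have card: "finite E" "card E \<le> mp.dim (forms d :: ('n, 'k) mpoly set)"
    using mp.card_le_dim_if_independent[OF finite_monomials forms_subset_span_monomials E(3,2)] by auto
  have "piece d \<subseteq> mp.span (proj ` E)"
    using E(4) unfolding piece_def proj.span_image by blast
  also have "proj ` E \<subseteq> insert 0 (proj ` (E - B))"
    using assms(2) by (auto simp: proj_eq_0_iff)
  then have "mp.span (proj ` E) \<subseteq> mp.span (insert 0 (proj ` (E - B)))" by (rule mp.span_mono)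
  finally have "piece d \<subseteq> mp.span (proj ` (E - B))" by simp
  then have "hilb d \<le> card (proj ` (E - B))"
    unfolding hilb_def using card(1) by (intro mp.dim_le_card) auto
  also have "\<dots> \<le> card (E - B)" using card(1) by (intro card_image_le) auto
  also have "\<dots> = card E - card B"
    using card(1) E(1) by (intro card_Diff_subset) (auto intro: finite_subset)
  finally show ?thesis using card(2) card_mono[OF card(1) E(1)] by linarith
qed

text \<open>This ties the initial degree, defined through forms in \<open>I\<close>, to the h-vector
  alone. If \<open>I\<close> has no nonzero form of degree \<open>d\<close>, then
  \<open>proj\<close> is injective on \<open>forms d\<close> and no dimension is lost.\<close>

lemma hilb_less_iff:
  "hilb d < mp.dim (forms d :: ('n, 'k) mpoly set) \<longleftrightarrow> I \<inter> forms d \<noteq> {0}"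
proof
  assume less: "hilb d < mp.dim (forms d :: ('n, 'k) mpoly set)"
  show "I \<inter> forms d \<noteq> {0}"
  proof
    assume I: "I \<inter> forms d = {0}"
    have "inj_on proj (forms d)"
    proof (rule inj_onI)
      fix p q assume "p \<in> forms d" "q \<in> forms d" "proj p = proj q"
      then have "p - q \<in> I \<inter> forms d" by (simp add: proj_eq_iff forms_diff)
      then show "p = q" using I by simp
    qed
    moreover obtain B :: "('n, 'k) mpoly set" where B: "B \<subseteq> forms d" "finite B" "mp.independent B" "forms d \<subseteq> mp.span B"
      "card B = mp.dim (forms d :: ('n, 'k) mpoly set)"
      using mp.finite_basis_exists[OF finite_monomials forms_subset_span_monomials] .
    moreover have "mp.span B = forms d"
      using B by (intro subset_antisym mp.span_minimal subspace_forms)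
    ultimately have "mp.independent (proj ` B)" "card (proj ` B) = card B"
      by (simp_all add: proj.independent_injective_image card_image inj_on_subset)
    then show False
      using mp.card_le_dim_if_independent(2)[OF finite_piece, of "proj ` B" d] B less
      by (auto simp: hilb_def piece_def)
  qed
next
  assume "I \<inter> forms d \<noteq> {0}"
  then obtain p where "p \<in> I" "p \<in> forms d" "p \<noteq> 0"
    using zero_mem forms_0 by blast
  then show "hilb d < mp.dim (forms d :: ('n, 'k) mpoly set)"
    using hilb_add_card_le[of "{p}" d] by simp
qed

lemma hilb_Suc_le_CARD: "hilb (Suc d) \<le> CARD('n) * hilb d"
proof -
  obtain B where B: "B \<subseteq> piece d" "finite B" "mp.independent B" "piece d \<subseteq> mp.span B"
    "card B = hilb d"
    using mp.finite_basis_exists[OF finite_piece, of d] unfolding hilb_def .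
  let ?S = "(\<lambda>(x, b). proj (var x * b)) ` (UNIV \<times> B)"
  have "proj p \<in> mp.span ?S" if "p \<in> forms (Suc d)" for p
    using that
  proof (induction p rule: forms_Suc_induct)
    case zero
    then show ?case by (simp add: proj.zero mp.span_zero)
  next
    case (add p q)
    then show ?case by (simp add: proj.add mp.span_add)
  next
    case (var_mult x q)
    interpret m: Vector_Spaces.linear scale_poly scale_poly "\<lambda>v. proj (var x * v)"
      using Vector_Spaces.linear_compose[OF linear_mult linear_proj] by (simp add: o_def)
    have "proj q \<in> mp.span B" using B(4) var_mult by (auto simp: piece_def)
    then have "proj (var x * proj q) \<in> mp.span ((\<lambda>v. proj (var x * v)) ` B)"
      unfolding m.span_image by blast
    moreover have "mp.span ((\<lambda>v. proj (var x * v)) ` B) \<subseteq> mp.span ?S"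
      by (rule mp.span_mono) auto
    ultimately show ?case by (auto simp: proj_mult_proj)
  qed
  then have "piece (Suc d) \<subseteq> mp.span ?S" by (auto simp: piece_def)
  then have "hilb (Suc d) \<le> card ?S" unfolding hilb_def using B(2) by (intro mp.dim_le_card) auto
  also have "\<dots> \<le> card ((UNIV :: 'n set) \<times> B)" using B(2) by (intro card_image_le) auto
  finally show ?thesis using B(5) by (simp add: card_cartesian_product)
qed

lemma hilb_le_if_mult_onto:
  assumes "\<And>p. p \<in> forms (Suc d) \<Longrightarrow> \<exists>q\<in>forms d. p - l * q \<in> I"
  shows "hilb (Suc d) \<le> hilb d"
proof -
  have "Vector_Spaces.linear scale_poly scale_poly (\<lambda>v. proj (l * v))"
    using Vector_Spaces.linear_compose[OF linear_mult linear_proj] by (simp add: o_def)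
  moreover have "piece (Suc d) \<subseteq> (\<lambda>v. proj (l * v)) ` piece d"
  proof
    fix v assume "v \<in> piece (Suc d)"
    then obtain p where p: "v = proj p" "p \<in> forms (Suc d)"
      by (auto simp: piece_def)
    moreover obtain q where "q \<in> forms d" "p - l * q \<in> I"
      using assms[OF p(2)] by blast
    ultimately have "v = proj p" "q \<in> forms d" "p - l * q \<in> I" by auto
    then have "v = proj (l * proj q)" "proj q \<in> piece d"
      by (simp_all add: proj_mult_proj proj_eq_iff proj_in_piece)
    then show "v \<in> (\<lambda>v. proj (l * v)) ` piece d" by blast
  qed
  ultimately show ?thesis
    unfolding hilb_def by (rule mp.dim_linear_image_le[OF finite_piece])
qed

text \<open>Forms of the next degree are generated by variables times forms of the present one, and
  a variable can be moved past \<open>l\<close>.\<close>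

lemma mult_onto_Suc:
  assumes "\<And>p. p \<in> forms (Suc d) \<Longrightarrow> \<exists>q\<in>forms d. p - l * q \<in> I"
    and "p \<in> forms (Suc (Suc d))"
  shows "\<exists>q\<in>forms (Suc d). p - l * q \<in> I"
  using assms(2)
proof (induction p rule: forms_Suc_induct)
  case zero
  then show ?case using zero_mem by (intro bexI[of _ 0]) simp_all
next
  case (add p p')
  then obtain q q' where "q \<in> forms (Suc d)" "p - l * q \<in> I" "q' \<in> forms (Suc d)" "p' - l * q' \<in> I"
    by blast
  moreover from this have "p + p' - l * (q + q') \<in> I"
    using add_mem[of "p - l * q" "p' - l * q'"] by (simp add: algebra_simps)
  ultimately show ?case using forms_add by blast
next
  case (var_mult x p)
  then obtain q where q: "q \<in> forms d" "p - l * q \<in> I" using assms(1) by blast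
  then have "var x * p - l * (var x * q) \<in> I"
    using mult_mem[of "p - l * q" "var x"] by (simp add: algebra_simps)
  moreover have "var x * q \<in> forms (Suc d)"
    using forms_mult[OF var_in_forms q(1)] by simp
  ultimately show ?case by blast
qed

text \<open>
  Were no linear form \<open>l\<close> to satisfy \<open>A\<^sub>d = l A\<^bsub>d-1\<^esub>\<close>, every \<open>l\<close> would have rank at most one
  on \<open>A\<^bsub>d-1\<^esub>\<close>. Start from a nonzero product \<open>a = x y v\<close>: both \<open>x\<close> and \<open>y\<close> have image spanned by \<open>a\<close>,
  and comparing with the product \<open>y (z v)\<close> every linear form \<open>z\<close> maps into that same line.
\<close>

lemma exists_onto_linear_form:
  assumes "hilb (Suc (Suc d)) \<le> 2"
  obtains l where "\<And>p. p \<in> forms (Suc (Suc d)) \<Longrightarrow> \<exists>q\<in>forms (Suc d). p - l * q \<in> I"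
proof (rule ccontr)
  assume contra: "\<not> thesis"
  let ?d = "Suc (Suc d)"
  define U where "U l = (\<lambda>q. proj (l * q)) ` forms (Suc d)" for l
  have sub: "mp.subspace (U l)" for l
  proof -
    interpret m: Vector_Spaces.linear scale_poly scale_poly "\<lambda>v. proj (l * v)"
      using Vector_Spaces.linear_compose[OF linear_mult linear_proj] by (simp add: o_def)
    show ?thesis unfolding U_def by (rule m.subspace_image[OF subspace_forms])
  qed
  have U_piece: "U l \<subseteq> piece ?d" if "l \<in> forms 1" for l
    unfolding U_def using forms_mult[OF that, of _ "Suc d"] proj_in_piece by auto
  have not_onto: "\<not> piece ?d \<subseteq> U l" for l
  proof
    assume *: "piece ?d \<subseteq> U l"
    have "\<exists>q\<in>forms (Suc d). p - l * q \<in> I" if "p \<in> forms ?d" for p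
    proof -
      have "proj p \<in> U l" using proj_in_piece[OF that] * by blast
      then show ?thesis unfolding U_def by (metis imageE proj_eq_iff)
    qed
    then show False using contra that by blast
  qed
  \<comment> \<open>Otherwise \<open>U l\<close> contains two independent vectors; as the piece has
    dimension at most 2, they span it, against \<open>not_onto\<close>.\<close>
  have line: "U l \<subseteq> mp.span {a}" if l: "l \<in> forms 1" and a: "a \<in> U l" "a \<noteq> 0" for l a
  proof
    fix b assume b: "b \<in> U l"
    show "b \<in> mp.span {a}"
    proof (rule ccontr)
      assume n: "b \<notin> mp.span {a}"
      then have ind: "mp.independent {b, a}"
        using a(2) mp.independent_empty by (intro mp.independent_insertI) auto
      have "b \<noteq> a" using n mp.span_base[of a "{a}"] by auto
      then have "mp.dim (piece ?d) \<le> card {b, a}" using assms by (simp add: hilb_def)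
      moreover have "{b, a} \<subseteq> piece ?d" using a(1) b U_piece[OF l] by blast
      ultimately have "piece ?d \<subseteq> mp.span {b, a}"
        by (intro mp.subset_span_if_card_ge_dim[OF finite_piece ind])
      also have "mp.span {b, a} \<subseteq> U l"
        using a(1) b by (intro mp.span_minimal sub) auto
      finally show False using not_onto by blast
    qed
  qed
  \<comment> \<open>If the piece were zero, even the zero form would be onto.\<close>
  have "\<not> forms ?d \<subseteq> I"
  proof
    assume *: "forms ?d \<subseteq> I"
    then have "piece ?d \<subseteq> {0}"
      by (auto simp: piece_def proj_eq_0_iff)
    also have "{0} \<subseteq> U 0"
      using mp.subspace_0[OF sub[of 0]] by simp
    finally have "piece ?d \<subseteq> U 0" .
    then show False using not_onto by blast
  qed
  then obtain x y v where xyv: "v \<in> forms d" "var x * (var y * v) \<notin> I"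
  proof -
    have "p \<in> I" if all: "\<And>x y v. v \<in> forms d \<Longrightarrow> var x * (var y * v) \<in> I" and "p \<in> forms ?d" for p
      using that(2)
    proof (induction p rule: forms_Suc_induct)
      case (var_mult x q)
      from var_mult show ?case
        by (induction q rule: forms_Suc_induct) (simp_all add: zero_mem add_mem all distrib_left)
    qed (simp_all add: zero_mem add_mem)
    then show ?thesis using that \<open>\<not> forms ?d \<subseteq> I\<close> by blast
  qed
  define a where "a = proj (var x * (var y * v))"
  have a: "a \<noteq> 0" using xyv(2) by (simp add: a_def proj_eq_0_iff)
  have lin: "l \<in> forms 1 \<Longrightarrow> l * v \<in> forms (Suc d)" for l
    using forms_mult[OF _ xyv(1), of l 1] by simp
  have ax: "a \<in> U (var x)" unfolding a_def U_def by (intro imageI lin var_in_forms)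
  have ay: "a \<in> U (var y)"
    unfolding a_def U_def using lin[OF var_in_forms, of x]
    by (intro image_eqI[of _ _ "var x * v"]) (simp_all add: mult.left_commute)
  note Ux = line[OF var_in_forms ax a] and Uy = line[OF var_in_forms ay a]
  have Uz: "U z \<subseteq> mp.span {a}" if z: "z \<in> forms 1" for z
  proof (cases "proj (z * (var y * v)) = 0")
    case True
    \<comment> \<open>When \<open>z\<close> kills \<open>y v\<close>, the form \<open>z + x\<close>
      still sends it to \<open>a\<close>. So the image of \<open>z + x\<close> lies on the line of
      \<open>a\<close>, and that of \<open>z\<close> does too, as a difference.\<close>
    have s: "z + var x \<in> forms 1" using z var_in_forms forms_add by blast
    have "proj ((z + var x) * (var y * v)) = a"
      using True by (simp add: distrib_right proj.add a_def)
    then have "a \<in> U (z + var x)"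
      unfolding U_def using lin[OF var_in_forms, of y] by blast
    note Us = line[OF s this a]
    show ?thesis
    proof
      fix b assume "b \<in> U z"
      then obtain q where q: "q \<in> forms (Suc d)" "b = proj (z * q)" by (auto simp: U_def)
      then have "b = proj ((z + var x) * q) - proj (var x * q)"
        by (simp add: distrib_right proj.add)
      moreover have "proj ((z + var x) * q) \<in> mp.span {a}" "proj (var x * q) \<in> mp.span {a}"
        using Us Ux q(1) by (auto simp: U_def)
      ultimately show "b \<in> mp.span {a}" by (simp add: mp.span_diff)
    qed
  next
    case False
    let ?b = "proj (z * (var y * v))"
    have "?b \<in> U (var y)"
      unfolding U_def using lin[OF z]
      by (intro image_eqI[of _ _ "z * v"]) (simp_all add: mult.left_commute)
    then have "?b \<in> mp.span {a}" using Uy by blast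
    then obtain k where k: "?b = scale_poly k a" by (auto simp: mp.span_singleton)
    then have "k \<noteq> 0" using False by auto
    then have "a = scale_poly (inverse k) ?b" using k by simp
    moreover have "?b \<in> U z" unfolding U_def using lin[OF var_in_forms, of y] by blast
    ultimately have "a \<in> U z" using mp.subspace_scale[OF sub] by metis
    then show ?thesis using line[OF z _ a] by blast
  qed
  have "proj p \<in> mp.span {a}" if "p \<in> forms ?d" for p
    using that
  proof (induction p rule: forms_Suc_induct)
    case (var_mult x q)
    then show ?case using Uz[OF var_in_forms, of x] by (auto simp: U_def)
  qed (simp_all add: proj.zero proj.add mp.span_zero mp.span_add)
  then have "piece ?d \<subseteq> mp.span {a}" by (auto simp: piece_def)
  also have "\<dots> \<subseteq> U (var x)" using ax by (intro mp.span_minimal sub) auto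
  finally show False using not_onto by blast
qed

text \<open>A form that is onto in degree \<open>d\<close> remains onto in degree
  \<open>d + 1\<close>. The bound on \<open>d\<close> matters: a polynomial ring in two variables
  has values 2 and 3 in degrees 1 and 2.\<close>

lemma hilb_Suc_le_if_le_2:
  assumes "2 \<le> d" "hilb d \<le> 2"
  shows "hilb (Suc d) \<le> hilb d"
proof -
  obtain n where n: "d = Suc (Suc n)" using assms(1) by (metis Suc_le_D numeral_2_eq_2 Suc_le_mono)
  obtain l where l: "\<And>p. p \<in> forms (Suc (Suc n)) \<Longrightarrow> \<exists>q\<in>forms (Suc n). p - l * q \<in> I"
    using exists_onto_linear_form assms(2) unfolding n by blast
  show ?thesis unfolding n by (rule hilb_le_if_mult_onto[OF mult_onto_Suc[OF l]])
qed

end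

section \<open>Level algebras\<close>

definition scale_pair ::
    "'k::field \<Rightarrow> ('n, 'k) mpoly \<times> ('n, 'k) mpoly \<Rightarrow> ('n, 'k) mpoly \<times> ('n, 'k) mpoly" where
  "scale_pair a k = (scale_poly a (fst k), scale_poly a (snd k))"

global_interpretation mpp: vector_space
    "scale_pair :: 'k::field \<Rightarrow> ('n, 'k) mpoly \<times> ('n, 'k) mpoly \<Rightarrow> _"
  by unfold_locales
    (simp_all add: scale_pair_def mp.scale_left_distrib mp.scale_right_distrib)

lemma fst_scale_pair [simp]: "fst (scale_pair a k) = scale_poly a (fst k)"
  and snd_scale_pair [simp]: "snd (scale_pair a k) = scale_poly a (snd k)"
  by (simp_all add: scale_pair_def)

lemma linear_fst: "Vector_Spaces.linear scale_pair scale_poly (fst :: _ \<Rightarrow> ('n, 'k::field) mpoly)"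
  and linear_snd: "Vector_Spaces.linear scale_pair scale_poly (snd :: _ \<Rightarrow> ('n, 'k::field) mpoly)"
  by unfold_locales simp_all

text \<open>The standard basis of \<open>forms 1 \<times> forms 1\<close>.\<close>

definition var_pairs :: "(('n, 'k::field) mpoly \<times> ('n, 'k) mpoly) set" where
  "var_pairs = range (\<lambda>x. (var x, 0)) \<union> range (\<lambda>x. (0, var x))"

lemma var_eq_iff: "(var x :: ('n, 'k::field) mpoly) = var y \<longleftrightarrow> x = y"
proof
  assume "(var x :: ('n, 'k) mpoly) = var y"
  then have "Poly_Mapping.single x (1::nat) = Poly_Mapping.single y 1"
    by (simp only: var_def single_one_eq_iff)
  then show "x = y" by (metis lookup_single_eq lookup_single_not_eq zero_neq_one)
qed simp

lemma var_neq_0: "var x \<noteq> 0"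
  by (metis lookup_single_eq lookup_zero var_def zero_neq_one)

lemma lookup_var:
  "Poly_Mapping.lookup (var x :: ('n, 'k::field) mpoly) (Poly_Mapping.single y 1) = (if x = y then 1 else 0)"
proof (cases "x = y")
  case False
  then have "Poly_Mapping.single x (1::nat) \<noteq> Poly_Mapping.single y 1"
    by (metis lookup_single_eq lookup_single_not_eq zero_neq_one)
  then show ?thesis using False by (simp add: var_def lookup_single)
qed (simp add: var_def)

lemma finite_var_pairs: "finite (var_pairs :: (('n::finite, 'k::field) mpoly \<times> _) set)"
  by (simp add: var_pairs_def)

lemma card_var_pairs: "card (var_pairs :: (('n::finite, 'k::field) mpoly \<times> _) set) = 2 * CARD('n)"
  unfolding var_pairs_def
  by (subst card_Un_disjoint) (auto simp: card_image inj_on_def var_eq_iff var_neq_0)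

lemma independent_var_pairs: "mpp.independent (var_pairs :: (('n, 'k::field) mpoly \<times> _) set)"
proof
  let ?S = "var_pairs :: (('n, 'k) mpoly \<times> _) set"
  assume "mpp.dependent ?S"
  then obtain s where s: "s \<in> ?S" "s \<in> mpp.span (?S - {s})"
    unfolding mpp.dependent_def by blast
  then consider x where "s = (var x, 0)" | x where "s = (0, var x)"
    unfolding var_pairs_def by blast
  then show False
  proof cases
    case (1 x)
    let ?U = "{k :: ('n, 'k) mpoly \<times> ('n, 'k) mpoly. Poly_Mapping.lookup (fst k) (Poly_Mapping.single x 1) = 0}"
    have "mpp.subspace ?U" by (simp add: mpp.subspace_def lookup_add)
    moreover have "?S - {s} \<subseteq> ?U" by (auto simp: 1 var_pairs_def lookup_var simp del: One_nat_def split: if_splits)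
    ultimately have "s \<in> ?U" using s(2) mpp.span_minimal by blast
    then show False by (simp add: 1 lookup_var del: One_nat_def)
  next
    case (2 x)
    let ?U = "{k :: ('n, 'k) mpoly \<times> ('n, 'k) mpoly. Poly_Mapping.lookup (snd k) (Poly_Mapping.single x 1) = 0}"
    have "mpp.subspace ?U" by (simp add: mpp.subspace_def lookup_add)
    moreover have "?S - {s} \<subseteq> ?U" by (auto simp: 2 var_pairs_def lookup_var simp del: One_nat_def split: if_splits)
    ultimately have "s \<in> ?U" using s(2) mpp.span_minimal by blast
    then show False by (simp add: 2 lookup_var del: One_nat_def)
  qed
qed

lemma lookup_var_mult: "Poly_Mapping.lookup (var x * q) (Poly_Mapping.single x 1 + n) = Poly_Mapping.lookup q n"
  for q :: "('n, 'k::field) mpoly"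
proof -
  have "Poly_Mapping.lookup (var x * Poly_Mapping.single m a) (Poly_Mapping.single x 1 + n)
      = Poly_Mapping.lookup (Poly_Mapping.single m a) n" for m and a :: 'k
    by (simp add: var_def mult_single lookup_single)
  then show ?thesis
    by (subst (1 2) poly_eq_sum_singles[of q]) (simp add: sum_distrib_left lookup_sum)
qed

lemma lookup_var_mult_eq_0:
  assumes "Poly_Mapping.lookup m x = 0"
  shows "Poly_Mapping.lookup (var x * q) m = (0 :: 'k::field)"
proof -
  have "m \<noteq> Poly_Mapping.single x 1 + n" for n
    using assms by (auto simp: lookup_add)
  then have "m \<notin> Poly_Mapping.keys (var x * q)"
    using keys_mult[of "var x" q] by (auto simp: var_def)
  then show ?thesis by (simp add: in_keys_iff)
qed

lemma linear_form_eqI: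
  assumes "p \<in> forms 1" "q \<in> forms 1"
    "\<And>x. Poly_Mapping.lookup p (Poly_Mapping.single x 1) = Poly_Mapping.lookup q (Poly_Mapping.single x 1)"
  shows "p = q"
proof (rule poly_mapping_eqI)
  fix m
  show "Poly_Mapping.lookup p m = Poly_Mapping.lookup q m"
  proof (cases "mon_degree m = 1")
    case True
    then obtain x n where "m = Poly_Mapping.single x 1 + n" "mon_degree n = 0"
      using mon_degree_SucE[of m 0] by auto
    then show ?thesis using assms(3) mon_degree_eq_0D[of n] by simp
  next
    case False
    then have "m \<notin> Poly_Mapping.keys p" "m \<notin> Poly_Mapping.keys q"
      using assms(1,2) by (auto simp: forms_def)
    then show ?thesis by (simp add: in_keys_iff)
  qed
qed

text \<open>Comparison of coefficients. For distinct \<open>x\<close> and \<open>y\<close> the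
  monomial y^2 does not occur in a multiple of \<open>x\<close>, so \<open>q x\<close> has no
  y-term; the monomial x z then equates the coefficient of \<open>x\<close> in \<open>q x\<close>
  with that of \<open>z\<close> in \<open>q z\<close> for one fixed \<open>z\<close>.\<close>

lemma proportional_to_vars:
  fixes q :: "'n::finite \<Rightarrow> ('n, 'k::field) mpoly"
  assumes q: "\<And>x. q x \<in> forms 1" and comm: "\<And>x y. var y * q x = var x * q y"
  obtains a where "\<And>x. q x = scale_poly a (var x)"
proof -
  let ?e = "\<lambda>x. Poly_Mapping.single x (1::nat)"
  fix z :: 'n
  define a where "a = Poly_Mapping.lookup (q z) (?e z)"
  have off: "Poly_Mapping.lookup (q x) (?e y) = 0" if "x \<noteq> y" for x y
  proof -
    have "Poly_Mapping.lookup (q x) (?e y) = Poly_Mapping.lookup (var y * q x) (?e y + ?e y)"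
      by (rule lookup_var_mult[symmetric])
    also have "\<dots> = Poly_Mapping.lookup (var x * q y) (?e y + ?e y)"
      by (simp only: comm[of y x])
    also have "\<dots> = 0"
      using that by (intro lookup_var_mult_eq_0) (simp add: lookup_add lookup_single)
    finally show ?thesis .
  qed
  have diag: "Poly_Mapping.lookup (q x) (?e x) = a" for x
  proof -
    have "Poly_Mapping.lookup (q x) (?e x) = Poly_Mapping.lookup (var z * q x) (?e z + ?e x)"
      by (rule lookup_var_mult[symmetric])
    also have "\<dots> = Poly_Mapping.lookup (var x * q z) (?e x + ?e z)"
      by (simp only: comm[of z x] add.commute)
    also have "\<dots> = a" unfolding a_def by (rule lookup_var_mult)
    finally show ?thesis .
  qed
  have "q x = scale_poly a (var x)" for x
  proof (rule linear_form_eqI)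
    show "Poly_Mapping.lookup (q x) (?e y) = Poly_Mapping.lookup (scale_poly a (var x)) (?e y)" for y
    proof (cases "x = y")
      case False
      then have "?e x \<noteq> ?e y" by (metis lookup_single_eq lookup_single_not_eq zero_neq_one)
      then show ?thesis using off[OF False] by (simp add: var_def lookup_single)
    qed (use diag in \<open>simp add: var_def\<close>)
  qed (intro q forms_scale var_in_forms)+
  then show ?thesis using that by blast
qed

section \<open>Duality between low degrees and the socle degree\<close>

locale level_graded_ideal = graded_ideal I for I :: "('n::finite, 'k::field) mpoly set" +
  fixes c :: nat
  assumes socle_eq_0: "d < c \<Longrightarrow> p \<in> forms d \<Longrightarrow> (\<And>x. var x * p \<in> I) \<Longrightarrow> p \<in> I"
    and no_linear_form: "I \<inter> forms 1 = {0}"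
begin

text \<open>Induction on \<open>k\<close>: below degree \<open>c\<close>, an element outside
  \<open>I\<close> has a product with some variable that is still outside \<open>I\<close>, so it
  can be pushed up degree by degree.\<close>

lemma pairing_nondegenerate:
  assumes "d + k \<le> c" "p \<in> forms d" "\<And>u. u \<in> forms k \<Longrightarrow> u * p \<in> I"
  shows "p \<in> I"
  using assms
proof (induction k arbitrary: d p)
  case 0
  then show ?case using one_in_forms_0 by (metis mult_1)
next
  case (Suc k)
  show ?case
  proof (rule socle_eq_0[of d])
    show "d < c" "p \<in> forms d" using Suc.prems by auto
    fix x
    show "var x * p \<in> I"
    proof (rule Suc.IH[of "Suc d"])
      show "Suc d + k \<le> c" "var x * p \<in> forms (Suc d)"
        using Suc.prems forms_mult[OF var_in_forms, of p d] by auto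
      fix u :: "('n, 'k) mpoly" assume "u \<in> forms k"
      then have "u * var x \<in> forms (Suc k)" using forms_mult[OF _ var_in_forms, of u k] by simp
      then show "u * (var x * p) \<in> I" using Suc.prems(3)[of "u * var x"] by (simp add: mult.assoc)
    qed
  qed
qed

lemma linear_functional_mult_right:
  assumes "Vector_Spaces.linear scale_poly (*) \<phi>"
  shows "Vector_Spaces.linear scale_poly (*) (\<lambda>p. \<phi> (proj (p * q)))"
proof -
  interpret \<phi>: Vector_Spaces.linear scale_poly "(*)" \<phi> by fact
  show ?thesis
    by unfold_locales
      (simp_all add: distrib_right distrib_left proj.add proj.scale \<phi>.add \<phi>.scale scale_poly_mult_left)
qed

text \<open>By nondegeneracy the linear forms embed in Hom(A_{c-1}, A_c). Concretely, a basis of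
  A_{c-1} and the coordinates on A_c give h_{c-1} h_c functionals on linear forms without a nonzero
  common zero.\<close>

lemma dim_linear_forms_le:
  assumes "1 \<le> c"
  shows "mp.dim (forms 1 :: ('n, 'k) mpoly set) \<le> hilb (c - 1) * hilb c"
proof -
  obtain S :: "('n, 'k) mpoly set" where S: "S \<subseteq> forms 1" "finite S" "mp.independent S"
    "forms 1 \<subseteq> mp.span S" "card S = mp.dim (forms 1 :: ('n, 'k) mpoly set)"
    using mp.finite_basis_exists[OF finite_monomials forms_subset_span_monomials] .
  obtain C where C: "C \<subseteq> piece (c - 1)" "finite C" "mp.independent C" "piece (c - 1) \<subseteq> mp.span C"
    "card C = hilb (c - 1)"
    using mp.finite_basis_exists[OF finite_piece] unfolding hilb_def .
  obtain B where B: "B \<subseteq> piece c" "finite B" "mp.independent B" "piece c \<subseteq> mp.span B"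
    "card B = hilb c"
    using mp.finite_basis_exists[OF finite_piece] unfolding hilb_def .
  obtain \<phi> where \<phi>: "\<And>b. Vector_Spaces.linear scale_poly (*) (\<phi> b)"
    "\<And>v. v \<in> mp.span B \<Longrightarrow> (\<And>b. b \<in> B \<Longrightarrow> \<phi> b v = 0) \<Longrightarrow> v = 0"
    using mp.separating_functionals[OF B(3)] by metis
  let ?f = "\<lambda>(u, b) p. \<phi> b (proj (p * u))"
  have lin: "Vector_Spaces.linear scale_poly (*) (?f j)" for j
    using linear_functional_mult_right[OF \<phi>(1)] by (cases j) simp
  obtain S' :: "('n, 'k) mpoly set" where S': "finite S'" "mp.independent S'" "S' \<subseteq> mp.span S"
    "card S \<le> card S' + card (C \<times> B)"
    "\<And>v j. v \<in> mp.span S' \<Longrightarrow> j \<in> C \<times> B \<Longrightarrow> ?f j v = 0"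
    by (rule mp.independent_in_common_kernel[of "C \<times> B" S ?f,
          OF finite_cartesian_product[OF C(2) B(2)] S(2,3) lin]) blast+
  have "S' = {}"
  proof (rule ccontr)
    assume "S' \<noteq> {}"
    then obtain v where v: "v \<in> S'" by blast
    have "mp.span S \<subseteq> forms 1" using S(1) by (intro mp.span_minimal subspace_forms)
    then have v1: "v \<in> forms 1" using v S'(3) by blast
    have zero: "proj (v * u) = 0" if "u \<in> C" for u
    proof -
      have "proj (v * u) \<in> piece c"
        using piece_mult[OF _ v1, of u "c - 1"] that C(1) assms by auto
      moreover have "\<phi> b (proj (v * u)) = 0" if "b \<in> B" for b
        using S'(5)[OF mp.span_base[OF v], of "(u, b)"] that \<open>u \<in> C\<close> by simp
      ultimately show ?thesis using \<phi>(2) B(4) by blast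
    qed
    interpret m: Vector_Spaces.linear scale_poly scale_poly "\<lambda>u. proj (v * u)"
      using Vector_Spaces.linear_compose[OF linear_mult linear_proj] by (simp add: o_def)
    have "v \<in> I"
    proof (rule pairing_nondegenerate[OF _ v1])
      show "1 + (c - 1) \<le> c" using assms by simp
      fix q :: "('n, 'k) mpoly" assume "q \<in> forms (c - 1)"
      then have "proj q \<in> mp.span C" using C(4) proj_in_piece by blast
      then have "proj (v * proj q) = 0" using m.eq_0_on_span zero by blast
      then show "q * v \<in> I" by (simp add: proj_mult_proj proj_eq_0_iff mult.commute)
    qed
    then have "v = 0" using no_linear_form v1 by blast
    then show False using v S'(2) mp.dependent_zero by blast
  qed
  then show ?thesis using S'(4) S(5) B(5) C(5) by (simp add: card_cartesian_product)
qed

end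

locale level_graded_ideal_3 = level_graded_ideal I c for I :: "(3, 'k::field) mpoly set" and c
begin

text \<open>
  Two functionals \<open>F\<close>, \<open>G\<close> are coordinates on \<open>A\<^sub>c\<close>. The pairs \<open>(p, q)\<close> of linear forms with
  \<open>F (p u) + G (q u) = 0\<close> for all \<open>u\<close> of degree \<open>c - 1\<close> form a space \<open>K\<close> of dimension at least
  \<open>6 - 3\<close>, and its minors \<open>p q' - p' q\<close> lie in \<open>I\<close> by levelness. If they all were multiples of one
  quadric, the alternating form they define would have a radical on a 3-dimensional subspace of \<open>K\<close>,
  which forces a nontrivial linear relation between \<open>F\<close> and \<open>G\<close>.
\<close>

lemma hilb_2_le_4:
  assumes c: "2 \<le> c" and "hilb (c - 1) \<le> 3" "hilb c = 2"
  shows "hilb 2 \<le> 4"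
proof (rule ccontr)
  assume "\<not> hilb 2 \<le> 4"
  then have h2: "5 \<le> hilb 2" by simp
  have dim2: "mp.dim (forms 2 :: (3, 'k) mpoly set) = 6"
    by (simp add: dim_forms card_monomials_3 numeral_eq_Suc)
  \<comment> \<open>If h_2 is at least 5, the quadrics in \<open>I\<close> form at most a line, so a
    single coefficient, taken at a monomial of a generator \<open>Q\<close>, decides whether such a
    quadric is zero.\<close>
  obtain m where m: "\<And>z. z \<in> I \<inter> forms 2 \<Longrightarrow> Poly_Mapping.lookup z m = 0 \<Longrightarrow> z = 0"
  proof (cases "I \<inter> forms 2 \<subseteq> {0}")
    case True
    then show ?thesis using that by blast
  next
    case False
    then obtain Q where Q: "Q \<in> I \<inter> forms 2" "Q \<noteq> 0" by blast
    obtain m where Qm: "Poly_Mapping.lookup Q m \<noteq> 0"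
      using Q(2) by (metis lookup_zero poly_mapping_eqI)
    have "z = 0" if z: "z \<in> I \<inter> forms 2" "Poly_Mapping.lookup z m = 0" for z
    proof -
      have "z \<in> mp.span {Q}"
      proof (rule ccontr)
        assume n: "z \<notin> mp.span {Q}"
        have "mp.independent {Q}" using Q(2) by simp
        with n have "mp.independent {z, Q}" by (rule mp.independent_insertI)
        moreover have "z \<noteq> Q" using n mp.span_base[of Q "{Q}"] by auto
        ultimately show False using hilb_add_card_le[of "{z, Q}" 2] z Q h2 dim2 by simp
      qed
      then obtain a where "z = scale_poly a Q" by (auto simp: mp.span_singleton)
      then show "z = 0" using z(2) Qm by simp
    qed
    then show ?thesis using that by blast
  qed
  obtain C where C: "C \<subseteq> piece (c - 1)" "finite C" "mp.independent C" "piece (c - 1) \<subseteq> mp.span C"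
    "card C = hilb (c - 1)"
    using mp.finite_basis_exists[OF finite_piece] unfolding hilb_def .
  obtain B where B: "B \<subseteq> piece c" "finite B" "mp.independent B" "piece c \<subseteq> mp.span B"
    "card B = hilb c"
    using mp.finite_basis_exists[OF finite_piece] unfolding hilb_def .
  obtain a b where ab: "B = {a, b}" "a \<noteq> b"
    using B(5) assms(3) by (auto simp: card_2_iff)
  obtain \<phi> where \<phi>: "\<And>b. Vector_Spaces.linear scale_poly (*) (\<phi> b)"
    "\<And>b b'. b \<in> B \<Longrightarrow> b' \<in> B \<Longrightarrow> \<phi> b b' = (if b' = b then 1 else 0)"
    "\<And>v. v \<in> mp.span B \<Longrightarrow> (\<And>b. b \<in> B \<Longrightarrow> \<phi> b v = 0) \<Longrightarrow> v = 0"
    using mp.separating_functionals[OF B(3)] by metis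
  define F where "F p = \<phi> a (proj p)" for p
  define G where "G p = \<phi> b (proj p)" for p
  have linF: "Vector_Spaces.linear scale_poly (*) F" and linG: "Vector_Spaces.linear scale_poly (*) G"
    unfolding F_def G_def using Vector_Spaces.linear_compose[OF linear_proj \<phi>(1)] by (simp_all add: o_def)
  interpret F: Vector_Spaces.linear scale_poly "(*)" F by (rule linF)
  interpret G: Vector_Spaces.linear scale_poly "(*)" G by (rule linG)
  have FG_zero: "p \<in> I" if "p \<in> forms c" "F p = 0" "G p = 0" for p
  proof -
    have "proj p \<in> mp.span B" using B(4) proj_in_piece[OF that(1)] by blast
    then have "proj p = 0" using \<phi>(3) that(2,3) by (auto simp: ab F_def G_def)
    then show ?thesis by (simp add: proj_eq_0_iff)
  qed
  have FG_indep: False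
    if rel: "\<And>p. p \<in> forms c \<Longrightarrow> r * F p + s * G p = 0" and "r \<noteq> 0 \<or> s \<noteq> 0" for r s
  proof -
    obtain pa pb where p: "pa \<in> forms c" "a = proj pa" "pb \<in> forms c" "b = proj pb"
      using B(1) ab by (auto simp: piece_def)
    have "\<phi> a a = 1" "\<phi> b a = 0" "\<phi> a b = 0" "\<phi> b b = 1"
      using \<phi>(2)[of a a] \<phi>(2)[of b a] \<phi>(2)[of a b] \<phi>(2)[of b b] ab by auto
    then have "F pa = 1" "G pa = 0" "F pb = 0" "G pb = 1"
      by (simp_all add: F_def G_def p)
    then show False using rel[OF p(1)] rel[OF p(3)] that(2) by simp
  qed
  have Suc_c: "Suc (c - 1) = c" using c by simp

  let ?S = "var_pairs :: ((3, 'k) mpoly \<times> _) set"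
  have S: "finite ?S" "mpp.independent ?S" "card ?S = 6"
    using finite_var_pairs independent_var_pairs card_var_pairs[where 'n = 3 and 'k = 'k] by simp_all
  let ?f = "\<lambda>u k. F (fst k * u) + G (snd k * u)"
  have linf: "Vector_Spaces.linear scale_pair (*) (?f u)" for u
    by unfold_locales (simp_all add: distrib_right distrib_left F.add G.add F.scale G.scale scale_poly_mult_left)
  obtain S' :: "((3, 'k) mpoly \<times> (3, 'k) mpoly) set" where S': "finite S'" "mpp.independent S'" "S' \<subseteq> mpp.span ?S"
    "card ?S \<le> card S' + card C"
    "\<And>v u. v \<in> mpp.span S' \<Longrightarrow> u \<in> C \<Longrightarrow> ?f u v = 0"
    by (rule mpp.independent_in_common_kernel[of C ?S ?f, OF C(2) S(1,2) linf]) blast+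
  then have "3 \<le> card S'" using S(3) C(5) assms(2) by simp
  then obtain T where "T \<subseteq> S'" "card T = 3" by (metis obtain_subset_with_card_n)
  then obtain k1 k2 k3 where k: "{k1, k2, k3} \<subseteq> S'" "k1 \<noteq> k2" "k1 \<noteq> k3" "k2 \<noteq> k3"
    by (auto simp: card_3_iff)
  define K where "K = mpp.span {k1, k2, k3}"
  have indK: "mpp.independent {k1, k2, k3}" using mpp.independent_mono[OF S'(2) k(1)] .
  have subK: "mpp.subspace K" by (simp add: K_def)
  have K_forms: "fst k \<in> forms 1" "snd k \<in> forms 1" if "k \<in> K" for k
  proof -
    have "mpp.subspace (forms 1 \<times> forms 1 :: ((3, 'k) mpoly \<times> _) set)"
      by (auto simp: mpp.subspace_def forms_add forms_scale scale_pair_def zero_prod_def)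
    moreover have "?S \<subseteq> forms 1 \<times> forms 1" using var_in_forms by (auto simp: var_pairs_def simp del: One_nat_def)
    ultimately have "mpp.span ?S \<subseteq> forms 1 \<times> forms 1" by (intro mpp.span_minimal)
    moreover have "K \<subseteq> mpp.span S'" unfolding K_def by (rule mpp.span_mono[OF k(1)])
    moreover have "mpp.span S' \<subseteq> mpp.span ?S" by (intro mpp.span_minimal S'(3)) simp
    ultimately have "k \<in> forms 1 \<times> forms 1" using that by blast
    then show "fst k \<in> forms 1" "snd k \<in> forms 1" by (simp_all only: mem_Times_iff)
  qed
  have K: "F (fst k * u) + G (snd k * u) = 0" if "k \<in> K" "u \<in> forms (c - 1)" for k u
  proof -
    have kS: "k \<in> mpp.span S'" using that(1) mpp.span_mono[OF k(1)] by (auto simp: K_def)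
    interpret f: Vector_Spaces.linear scale_poly "(*)" "\<lambda>v. ?f v k"
      by unfold_locales
        (simp_all add: distrib_left F.add G.add F.scale G.scale scale_poly_mult_right)
    have "proj u \<in> mp.span C" using C(4) proj_in_piece[OF that(2)] by blast
    then have "?f (proj u) k = 0" using f.eq_0_on_span S'(5)[OF kS] by blast
    then show ?thesis by (simp add: F_def G_def proj_mult_proj)
  qed
  define w where "w k k' = fst k * snd k' - fst k' * snd k" for k k' :: "(3, 'k) mpoly \<times> (3, 'k) mpoly"
  have w_mem: "w k k' \<in> I \<inter> forms 2" if kk: "k \<in> K" "k' \<in> K" for k k'
  proof -
    note f = K_forms[OF kk(1)] K_forms[OF kk(2)]
    have "fst k * snd k' \<in> forms (1 + 1)" "fst k' * snd k \<in> forms (1 + 1)"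
      by (intro forms_mult f)+
    then have w2: "w k k' \<in> forms 2"
      unfolding w_def one_add_one by (rule forms_diff)
    moreover have "w k k' \<in> I"
    proof (rule pairing_nondegenerate[OF _ w2])
      show "2 + (c - 2) \<le> c" using c by simp
      fix u :: "(3, 'k) mpoly" assume u: "u \<in> forms (c - 2)"
      have lu: "l * u \<in> forms (c - 1)" if "l \<in> forms 1" for l
        using forms_mult[OF that u] c by (simp add: numeral_2_eq_2 Suc_diff_Suc)
      \<comment> \<open>Write \<open>k\<close> = (p, q) and \<open>k'\<close> = (p', q'). The first
        two relations give F(p q' u) = - G(q q' u) = F(p' q u), the last two likewise G(q p' u) =
        G(q' p u). So both coordinates of \<open>u * w k k'\<close> vanish.\<close>
      have e: "F (fst k * (snd k' * u)) + G (snd k * (snd k' * u)) = 0"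
        "F (fst k' * (snd k * u)) + G (snd k' * (snd k * u)) = 0"
        "F (fst k * (fst k' * u)) + G (snd k * (fst k' * u)) = 0"
        "F (fst k' * (fst k * u)) + G (snd k' * (fst k * u)) = 0"
        by (intro K kk lu f)+
      have s: "snd k * (snd k' * u) = snd k' * (snd k * u)" "fst k * (fst k' * u) = fst k' * (fst k * u)"
        and uw: "u * w k k' = fst k * (snd k' * u) - fst k' * (snd k * u)"
          "u * w k k' = snd k' * (fst k * u) - snd k * (fst k' * u)"
        by (simp_all add: w_def right_diff_distrib ac_simps)
      have "F (fst k * (snd k' * u)) = F (fst k' * (snd k * u))"
        using e(1,2) unfolding s(1) by (simp add: eq_neg_iff_add_eq_0[symmetric])
      then have "F (u * w k k') = 0" unfolding uw(1) F.diff by simp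
      moreover have "G (snd k' * (fst k * u)) = G (snd k * (fst k' * u))"
        using e(3,4) unfolding s(2) by (simp add: add_eq_0_iff)
      then have "G (u * w k k') = 0" unfolding uw(2) G.diff by simp
      moreover have "u * w k k' \<in> forms c" using forms_mult[OF u w2] c by (simp only: le_add_diff_inverse2)
      ultimately show "u * w k k' \<in> I" using FG_zero by blast
    qed
    ultimately show ?thesis by blast
  qed
  define \<omega> where "\<omega> k k' = Poly_Mapping.lookup (w k k') m" for k k'
  have w_zero: "fst k * snd k' = fst k' * snd k" if "k \<in> K" "k' \<in> K" "\<omega> k k' = 0" for k k'
    using m[OF w_mem[OF that(1,2)]] that(3) by (simp add: \<omega>_def w_def)
  have \<omega>_lin: "\<omega> (k + l) k' = \<omega> k k' + \<omega> l k'" "\<omega> (scale_pair r k) k' = r * \<omega> k k'" for k l k' r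
    by (simp_all add: \<omega>_def w_def distrib_right distrib_left lookup_add lookup_minus algebra_simps
        scale_poly_mult_left scale_poly_mult_right)
  have \<omega>_alt: "\<omega> k k = 0" "\<omega> k k' = - \<omega> k' k" for k k'
    by (simp_all add: \<omega>_def w_def lookup_minus)
  have kK: "k1 \<in> K" "k2 \<in> K" "k3 \<in> K" by (auto simp: K_def intro: mpp.span_base)
  \<comment> \<open>An alternating form on a 3-dimensional space is degenerate. The vector
    \<open>?k\<close> below is the standard kernel vector of a skew 3 by 3 matrix; it is zero only
    if the form is zero, and then \<open>k1\<close> serves.\<close>
  obtain k0 where k0: "k0 \<in> K" "k0 \<noteq> 0" "\<omega> k0 k1 = 0" "\<omega> k0 k2 = 0" "\<omega> k0 k3 = 0"
  proof (cases "\<omega> k2 k3 = 0 \<and> \<omega> k1 k3 = 0 \<and> \<omega> k1 k2 = 0")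
    case True
    moreover have "k1 \<noteq> 0" using indK mpp.dependent_zero by blast
    ultimately show ?thesis using that[of k1] kK \<omega>_alt(1) by blast
  next
    case False
    let ?k = "scale_pair (\<omega> k2 k3) k1 + scale_pair (- \<omega> k1 k3) k2 + scale_pair (\<omega> k1 k2) k3"
    have "?k \<noteq> 0"
    proof
      assume 0: "?k = 0"
      define r where "r v = (if v = k1 then \<omega> k2 k3 else if v = k2 then - \<omega> k1 k3 else \<omega> k1 k2)" for v
      have "(\<Sum>v\<in>{k1, k2, k3}. scale_pair (r v) v) = 0"
        using 0 k(2-4) by (simp add: r_def algebra_simps)
      then have "r v = 0" if "v \<in> {k1, k2, k3}" for v
        using mpp.independentD[OF indK, of "{k1, k2, k3}" r v] that by simp
      from this[of k1] this[of k2] this[of k3] show False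
        using False k(2-4) by (auto simp: r_def split: if_splits)
    qed
    moreover have "\<omega> ?k k1 = 0" "\<omega> ?k k2 = 0" "\<omega> ?k k3 = 0"
      using \<omega>_alt(2)[of k2 k1] \<omega>_alt(2)[of k3 k1] \<omega>_alt(2)[of k3 k2]
      unfolding \<omega>_lin by (simp_all add: \<omega>_alt(1))
    moreover have "?k \<in> K" by (intro mpp.subspace_add mpp.subspace_scale subK kK)
    ultimately show ?thesis using that by blast
  qed
  have "K \<subseteq> {k. fst k0 * snd k = fst k * snd k0}"
    unfolding K_def
  proof (rule mpp.span_minimal)
    show "{k1, k2, k3} \<subseteq> {k. fst k0 * snd k = fst k * snd k0}"
      using w_zero[OF k0(1) kK(1) k0(3)] w_zero[OF k0(1) kK(2) k0(4)] w_zero[OF k0(1) kK(3) k0(5)]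
      by simp
    show "mpp.subspace {k. fst k0 * snd k = fst k * snd k0}"
      by (simp add: mpp.subspace_def distrib_left distrib_right scale_poly_mult_left scale_poly_mult_right)
  qed
  then have rad: "fst k0 * snd k = fst k * snd k0" if "k \<in> K" for k
    using that by blast
  \<comment> \<open>\<open>K\<close> and the space of linear forms both have dimension 3, so an
    injective linear map between them is onto.\<close>
  have onto: "\<exists>k\<in>K. f k = l" if "l \<in> forms 1"
    "Vector_Spaces.linear scale_pair scale_poly f" "\<And>k. k \<in> K \<Longrightarrow> f k \<in> forms 1"
    "\<And>k. k \<in> K \<Longrightarrow> f k = 0 \<Longrightarrow> k = 0"
    for f :: "(3, 'k) mpoly \<times> (3, 'k) mpoly \<Rightarrow> (3, 'k) mpoly" and l
  proof -
    interpret f: Vector_Spaces.linear scale_pair scale_poly f by fact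
    have inj: "inj_on f (mpp.span {k1, k2, k3})"
      using that(4) f.inj_on_iff_eq_0[OF subK] by (simp add: K_def)
    then have "mp.independent (f ` {k1, k2, k3})"
      by (rule f.independent_injective_image[OF indK])
    moreover have "card (f ` {k1, k2, k3}) = card {k1, k2, k3}"
      by (rule card_image[OF inj_on_subset[OF inj mpp.span_superset]])
    moreover have "card {k1, k2, k3} = 3" using k(2-4) by simp
    moreover have "f ` {k1, k2, k3} \<subseteq> forms 1" using that(3) kK by auto
    moreover have "mp.dim (forms 1 :: (3, 'k) mpoly set) = 3"
      by (simp add: dim_forms card_monomials_3)
    ultimately have "forms 1 \<subseteq> mp.span (f ` {k1, k2, k3})"
      by (intro mp.subset_span_if_card_ge_dim[OF finite_monomials forms_subset_span_monomials]) auto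
    then show ?thesis using that(1) unfolding f.span_image K_def by blast
  qed
  show False
  \<comment> \<open>Let \<open>k0\<close> = (p0, q0), so that p0 q = p q0 for all (p, q) in
    \<open>K\<close>. If p0 = 0, then always p = 0, while q runs through all linear forms, and
    \<open>G\<close> vanishes in degree \<open>c\<close>. If p0 is nonzero, then p determines q and
    takes every value; cancelling p0 leaves y q_x = x q_y, hence q_x = r x for one constant r, and F
    + r G vanishes in degree \<open>c\<close>. Both contradict \<open>FG_indep\<close>.\<close>
  proof (cases "fst k0 = 0")
    case True
    then have "snd k0 \<noteq> 0" using k0(2) by (simp add: prod_eq_iff)
    then have fst0: "fst k = 0" if "k \<in> K" for k using rad[OF that] True by simp
    have "\<exists>k\<in>K. snd k = l" if "l \<in> forms 1" for l
      using onto[OF that linear_snd] K_forms(2) fst0 by (auto simp: prod_eq_iff)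
    then have G0: "G (l * u) = 0" if "l \<in> forms 1" "u \<in> forms (c - 1)" for l u
      using K[of _ u] fst0 that by (metis F.zero add_0 mult_zero_left)
    have "G p = 0" if "p \<in> forms (Suc (c - 1))" for p
      using that
      by (induction p rule: forms_Suc_induct) (simp_all only: G.zero G.add add_0_left G0 var_in_forms)
    then show False using FG_indep[of 0 1] unfolding Suc_c by simp
  next
    case False
    have "\<exists>k\<in>K. fst k = l" if "l \<in> forms 1" for l
    proof (rule onto[OF that linear_fst])
      show "k = 0" if "k \<in> K" "fst k = 0" for k
        using rad[OF that(1)] that(2) False by (simp add: prod_eq_iff)
    qed (rule K_forms(1))
    then have "\<exists>k\<in>K. fst k = var x" for x using var_in_forms by blast
    then obtain \<kappa> where \<kappa>: "\<And>x. \<kappa> x \<in> K" "\<And>x. fst (\<kappa> x) = var x" by metis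
    have rad': "fst k0 * snd (\<kappa> x) = var x * snd k0" for x using rad[OF \<kappa>(1)[of x]] \<kappa>(2) by simp
    have "fst k0 * (var y * snd (\<kappa> x)) = fst k0 * (var x * snd (\<kappa> y))" for x y
      using rad'[of x] rad'[of y] by (metis mult.left_commute)
    then have "var y * snd (\<kappa> x) = var x * snd (\<kappa> y)" for x y using False by simp
    then obtain r where r: "\<And>x. snd (\<kappa> x) = scale_poly r (var x)"
      using proportional_to_vars[of "\<lambda>x. snd (\<kappa> x)"] K_forms(2) \<kappa>(1) by metis
    have FG0: "F (var x * u) + r * G (var x * u) = 0" if "u \<in> forms (c - 1)" for x u
      using K[OF \<kappa>(1)[of x] that] by (simp add: \<kappa>(2) r scale_poly_mult_left G.scale)
    have "F p + r * G p = 0" if "p \<in> forms (Suc (c - 1))" for p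
      using that
    proof (induction p rule: forms_Suc_induct)
      case (add p q)
      have "F (p + q) + r * G (p + q) = (F p + r * G p) + (F q + r * G q)"
        by (simp add: F.add G.add distrib_left)
      with add show ?case by simp
    qed (simp_all add: F.zero G.zero FG0)
    then show False using FG_indep[of 1 r] unfolding Suc_c by simp
  qed
qed

end

section \<open>Bounds for the $h$-vector\<close>

lemma sum_reflect: "b \<le> c \<Longrightarrow> (\<Sum>d=b..c. g (c - d)) = (\<Sum>d<c - b + 1. g d)" for b c :: nat
  by (rule sum.reindex_bij_witness[of _ "\<lambda>d. c - d" "\<lambda>d. c - d"]) auto

text \<open>The numerical facts extracted from a level algebra of codimension 3; in this locale the
  bounds become statements about integers only.\<close>

locale level_hvec =
  fixes H :: "nat \<Rightarrow> nat" and c :: nat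
  assumes H_0: "H 0 = 1" and H_1: "H 1 = 3" and c_ge_1: "1 \<le> c"
    and H_pos: "d \<le> c \<Longrightarrow> 1 \<le> H d" and H_zero: "c < d \<Longrightarrow> H d = 0"
    and H_le: "H d \<le> (2 + d) choose d"
    and H_growth: "H (Suc d) \<le> 3 * H d"
    and H_decreasing: "2 \<le> d \<Longrightarrow> H d \<le> 2 \<Longrightarrow> H (Suc d) \<le> H d"
    and H_dual: "3 \<le> H (c - 1) * H c"
    and H_quadrics: "2 \<le> c \<Longrightarrow> H (c - 1) \<le> 3 \<Longrightarrow> H c = 2 \<Longrightarrow> H 2 \<le> 4"
begin

definition hx :: "int \<Rightarrow> int" where
  "hx n = (if n < 0 \<or> n > int c then 0 else int (H (nat n)))"

definition fx :: "int \<Rightarrow> int" where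
  "fx n = hx n - 3 * hx (n - 1) + 3 * hx (n - 2) - hx (n - 3)"

definition t where "t = (LEAST d. H d < (2 + d) choose d)"
definition i where "i = (LEAST n. n > 0 \<and> fx n > 0)"
definition j where "j = (GREATEST n. fx n > 0)"
definition m where "m = (GREATEST n. n < int c + 3 \<and> fx n < 0)"
definition e where "e = (\<Sum>d = 0..c. H d)"

lemma hx_int [simp]: "hx (int d) = int (H d)"
  using H_zero[of d] by (simp add: hx_def)

lemma hx_numeral [simp]: "hx (numeral d) = int (H (numeral d))"
  using hx_int[of "numeral d"] by (simp del: hx_int)

lemma hx_0 [simp]: "hx 0 = 1" and hx_1 [simp]: "hx 1 = 3"
  using hx_int[of 0] hx_int[of 1] H_0 H_1 by (simp_all del: hx_int)

lemma hx_neg [simp]: "n < 0 \<Longrightarrow> hx n = 0" and hx_gt: "int c < n \<Longrightarrow> hx n = 0"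
  by (simp_all add: hx_def)

lemma fx_gt: "int c + 3 < n \<Longrightarrow> fx n = 0"
  by (simp add: fx_def hx_gt)

lemma fx_1: "fx 1 = 0" and fx_2: "fx 2 = int (H 2) - 6"
  and fx_3: "fx 3 = int (H 3) - 3 * int (H 2) + 8"
  and fx_4: "fx 4 = int (H 4) - 3 * int (H 3) + 3 * int (H 2) - 3"
  and fx_5: "fx 5 = int (H 5) - 3 * int (H 4) + 3 * int (H 3) - int (H 2)"
  and fx_6: "fx 6 = int (H 6) - 3 * int (H 5) + 3 * int (H 4) - int (H 3)"
  by (simp_all add: fx_def)

text \<open>The entry \<open>hx (int c - 2)\<close> stays in extended form because its index is
  negative for \<open>c = 1\<close>.\<close>

lemma fx_c3: "fx (int c + 3) = - int (H c)"
  and fx_c2: "fx (int c + 2) = 3 * int (H c) - int (H (c - 1))"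
  and fx_c1: "fx (int c + 1) = 3 * int (H (c - 1)) - 3 * int (H c) - hx (int c - 2)"
proof -
  have "hx (int c - 1) = int (H (c - 1))"
    using hx_int[of "c - 1"] c_ge_1 by (simp add: of_nat_diff del: hx_int)
  then show "fx (int c + 3) = - int (H c)"
    "fx (int c + 2) = 3 * int (H c) - int (H (c - 1))"
    "fx (int c + 1) = 3 * int (H (c - 1)) - 3 * int (H c) - hx (int c - 2)"
    by (simp_all add: fx_def hx_gt)
qed

lemma H_eventually_le_1:
  assumes "2 \<le> d" "d \<le> k" "H d \<le> 1"
  shows "H k \<le> 1"
  using assms(2)
proof (induction k rule: dec_induct)
  case (step n)
  then show ?case using H_decreasing[of n] assms(1) by linarith
qed (rule assms(3))

text \<open>A value at most 1 would persist up to degree \<open>c\<close>, so that h_{c-1} h_c \<le>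
  1, against \<open>H_dual\<close>.\<close>

lemma H_ge_2:
  assumes "2 \<le> d" "d < c"
  shows "2 \<le> H d"
proof (rule ccontr)
  assume "\<not> 2 \<le> H d"
  then have "H (c - 1) \<le> 1" "H c \<le> 1"
    using H_eventually_le_1[of d "c - 1"] H_eventually_le_1[of d c] assms by auto
  then have "H (c - 1) * H c \<le> 1 * 1" by (intro mult_mono) auto
  then show False using H_dual by simp
qed

lemma e_split: "k \<le> c \<Longrightarrow> e = (\<Sum>d<k. H d) + (\<Sum>d=k..c. H d)"
  unfolding e_def
  by (subst sum.union_disjoint[symmetric]) (auto intro!: sum.cong)

lemma e_ge:
  assumes "2 \<le> k" "k \<le> c"
  shows "e \<ge> (\<Sum>d<k. H d) + 2 * (c - k) + 1"
proof -
  have "(\<Sum>d=k..c. H d) = (\<Sum>d=k..<c. H d) + H c"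
    using assms(2) by (simp add: sum.atLeastLessThan_Suc flip: atLeastLessThanSuc_atLeastAtMost)
  moreover have "(\<Sum>d=k..<c. H d) \<ge> (\<Sum>d=k..<c. 2)"
    using assms by (intro sum_mono H_ge_2) auto
  ultimately show ?thesis using e_split[OF assms(2)] H_pos[of c] by simp
qed

lemma i_eqI:
  assumes "0 < n" "0 < fx n" "\<And>k. 0 < k \<Longrightarrow> k < n \<Longrightarrow> fx k \<le> 0"
  shows "i = n"
  unfolding i_def
proof (rule Least_equality)
  show "n \<le> k" if "k > 0 \<and> fx k > 0" for k
    using assms(3)[of k] that by linarith
qed (use assms in simp)

lemma j_eqI:
  assumes "0 < fx n" "\<And>k. n < k \<Longrightarrow> fx k \<le> 0"
  shows "j = n"
  unfolding j_def
proof (rule Greatest_equality)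
  show "k \<le> n" if "fx k > 0" for k
    using assms(2)[of k] that by linarith
qed (use assms in simp)

lemma m_eqI:
  assumes "n < int c + 3" "fx n < 0" "\<And>k. n < k \<Longrightarrow> k < int c + 3 \<Longrightarrow> fx k \<ge> 0"
  shows "m = n"
  unfolding m_def
proof (rule Greatest_equality)
  show "k \<le> n" if "k < int c + 3 \<and> fx k < 0" for k
    using assms(3)[of k] that by linarith
qed (use assms in simp)

lemma t_eqI:
  assumes "H n < (2 + n) choose n" "\<And>k. k < n \<Longrightarrow> H k = (2 + k) choose k"
  shows "t = n"
  unfolding t_def
proof (rule Least_equality)
  show "n \<le> k" if "H k < (2 + k) choose k" for k
    using assms(2)[of k] that by (metis less_irrefl not_le)
qed (use assms in simp)

lemma int_range:
  "0 < (k::int) \<Longrightarrow> k < 3 \<Longrightarrow> k = 1 \<or> k = 2"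
  "0 < (k::int) \<Longrightarrow> k < 4 \<Longrightarrow> k = 1 \<or> k = 2 \<or> k = 3"
  "0 < (k::int) \<Longrightarrow> k < 5 \<Longrightarrow> k = 1 \<or> k = 2 \<or> k = 3 \<or> k = 4"
  "0 < (k::int) \<Longrightarrow> k < 6 \<Longrightarrow> k = 1 \<or> k = 2 \<or> k = 3 \<or> k = 4 \<or> k = 5"
  by presburger+

text \<open>With t = 2 the claim becomes i (c + 3) \<le> 3 e. Every failure of f to be positive
  pushes \<open>i\<close> up but forces larger entries: for \<open>4 \<le> c\<close>, f(3) \<le> 0
  gives h_2 = 4, and f(4) \<le> 0 in addition gives h_3 = 4. The remaining degrees before
  \<open>c\<close> contribute at least 2 each. Small \<open>c\<close> is treated separately.\<close>

lemma lower_bound_if_H_2_le_4: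
  assumes "H 2 \<le> 4"
  shows "int t * i * (int c + 3) \<le> 6 * int e"
proof -
  have t2: "t = 2"
  proof (rule t_eqI)
    show "H 2 < (2 + 2) choose 2" using assms by (simp add: numeral_eq_Suc)
    show "H k = (2 + k) choose k" if "k < 2" for k
      using that H_0 H_1 by (auto simp: less_2_cases_iff)
  qed
  have f2: "fx 2 \<le> 0" using assms by (simp add: fx_2)
  note f1 = fx_1[THEN eq_refl]
  have i3: "i = 3" if "0 < fx 3"
    using that f2 f1 by (intro i_eqI) (auto dest: int_range)
  have i4: "i = 4" if "fx 3 \<le> 0" "0 < fx 4"
    using that f2 f1 by (intro i_eqI) (auto dest: int_range)
  have i5: "i = 5" if "fx 3 \<le> 0" "fx 4 \<le> 0" "0 < fx 5"
    using that f2 f1 by (intro i_eqI) (auto dest: int_range)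
  have i6: "i = 6" if "fx 3 \<le> 0" "fx 4 \<le> 0" "fx 5 \<le> 0" "0 < fx 6"
    using that f2 f1 by (intro i_eqI) (auto dest: int_range)
  have sum2: "(\<Sum>d<2. H d) = 4" using H_0 H_1 by (simp add: numeral_2_eq_2)
  have sum3: "(\<Sum>d<3. H d) = 4 + H 2" using sum2 by (simp add: numeral_eq_Suc)
  have sum4: "(\<Sum>d<4. H d) = 4 + H 2 + H 3" using sum3 by (simp add: numeral_eq_Suc)
  have sum5: "(\<Sum>d<5. H d) = 4 + H 2 + H 3 + H 4" using sum4 by (simp add: numeral_eq_Suc)
  have goal: "i * (int c + 3) \<le> 3 * int e"
  proof -
    consider "c = 1" | "c = 2" | "c = 3" | "4 \<le> c" using c_ge_1 by linarith
    then show ?thesis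
    proof cases
      case 1
      then have "H 2 = 0" "H 3 = 0" using H_zero by simp_all
      then have "i = 3" by (intro i3) (simp add: fx_3)
      moreover have "e = 4" unfolding e_def unfolding 1 using H_0 H_1 by simp
      ultimately show ?thesis using 1 by simp
    next
      case 2
      then have z: "H 3 = 0" "H 4 = 0" using H_zero by simp_all
      have e: "e = 4 + H 2" using e_split[of 2] sum2 2 by simp
      have H2: "1 \<le> H 2" using H_pos 2 by simp
      show ?thesis
      proof (cases "0 < fx 3")
        case True
        then show ?thesis using i3 e H2 2 by simp
      next
        case False
        then have "0 < fx 4" "3 \<le> H 2" using z by (auto simp: fx_3 fx_4)
        then show ?thesis using i4 False e 2 by simp
      qed
    next
      case 3
      then have z: "H 4 = 0" "H 5 = 0" using H_zero by simp_all
      have e: "e = 4 + H 2 + H 3" using e_split[of 3] sum3 3 by simp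
      have H23: "1 \<le> H 2" "1 \<le> H 3" using H_pos 3 by simp_all
      consider "0 < fx 3" | "fx 3 \<le> 0" "0 < fx 4" | "fx 3 \<le> 0" "fx 4 \<le> 0" by linarith
      then show ?thesis
      proof cases
        case 1
        then show ?thesis using i3 e H23 3 by simp
      next
        case 2
        then have "3 \<le> H 2" using H23 by (simp add: fx_3)
        then show ?thesis using 2 i4 e H23 3 by simp
      next
        case f: 3
        then have "H 3 \<ge> 3" using H23 z assms by (simp add: fx_3 fx_4)
        moreover from this have "0 < fx 5" using z assms by (simp add: fx_5)
        then have "i = 5" using f i5 by blast
        moreover have "H 2 \<ge> 4" using f \<open>H 3 \<ge> 3\<close> by (simp add: fx_3)
        ultimately show ?thesis using e 3 by simp
      qed
    next
      case 4
      then have g: "2 \<le> H 2" "2 \<le> H 3" "1 \<le> H 4" using H_ge_2 H_pos by simp_all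
      consider "0 < fx 3" | "fx 3 \<le> 0" "0 < fx 4" | "fx 3 \<le> 0" "fx 4 \<le> 0" "0 < fx 5"
        | "fx 3 \<le> 0" "fx 4 \<le> 0" "fx 5 \<le> 0" by linarith
      then show ?thesis
      proof cases
        case 1
        then show ?thesis using i3 e_ge[of 2] sum2 4 by simp
      next
        case 2
        then have "H 2 = 4" using assms g by (simp add: fx_3)
        then show ?thesis using 2 i4 e_ge[of 3] sum3 4 by simp
      next
        case 3
        then have H2: "H 2 = 4" using assms g by (simp add: fx_3)
        with 3 g have "H 3 = 4" by (simp add: fx_3 fx_4)
        then show ?thesis using H2 3 i5 e_ge[of 4] sum4 4 by simp
      next
        \<comment> \<open>Only (1, 3, 4, 4, 3) and (1, 3, 4, 4, 3, 1) remain here; the second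
          attains equality.\<close>
        case f: 4
        then have H2: "H 2 = 4" using assms g by (simp add: fx_3)
        with f g have "H 3 = 4" by (simp add: fx_3 fx_4)
        note H = H2 this
        then have "H 4 = 3" "H 5 \<le> 1" using f by (simp_all add: fx_4 fx_5)
        note H = H this
        have "c \<le> 5" using H_ge_2[of 5] H by linarith
        then have "H 6 = 0" using H_zero by simp
        then have "0 < fx 6" using H by (simp add: fx_6)
        then have i: "i = 6" using f i6 by blast
        have "c = 4 \<or> c = 5" using \<open>c \<le> 5\<close> 4 by linarith
        then show ?thesis
        proof
          assume "c = 4"
          then show ?thesis using i e_split[of 4] sum4 H by simp
        next
          assume "c = 5"
          then show ?thesis using i e_split[of 5] sum5 H H_pos[of 5] by simp
        qed
      qed
    qed
  qed
  show ?thesis using goal by (simp add: t2)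
qed

lemma double_choose: "2 * ((2 + d) choose d) = (d + 1) * (d + 2)"
proof -
  have "(2 + d) choose d = (2 + d) choose 2" by (subst binomial_symmetric) auto
  then show ?thesis by (simp add: choose_two)
qed

lemma sum_double_choose: "3 * (\<Sum>d<n. (d + 1) * (d + 2)) = n * (n + 1) * (n + 2)" for n :: nat
  by (induction n) (simp_all add: algebra_simps)

lemma sum_choose: "6 * (\<Sum>d<n. (2 + d) choose d) = n * (n + 1) * (n + 2)" for n :: nat
proof -
  have "6 * (\<Sum>d<n. (2 + d) choose d) = 3 * (\<Sum>d<n. 2 * ((2 + d) choose d))"
    by (simp add: sum_distrib_left)
  then show ?thesis unfolding double_choose sum_double_choose .
qed

lemma sum_H_le: "6 * (\<Sum>d<n. H d) \<le> n * (n + 1) * (n + 2)"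
proof -
  have "2 * H d \<le> (d + 1) * (d + 2)" for d using H_le[of d] double_choose[of d] by linarith
  then have "2 * (\<Sum>d<n. H d) \<le> (\<Sum>d<n. (d + 1) * (d + 2))"
    unfolding sum_distrib_left by (intro sum_mono) auto
  then show ?thesis using sum_double_choose[of n] by linarith
qed

lemma upper_bound_if_last_le:
  assumes last: "H (c - 1) \<le> H c + 1"
  shows "6 * int e \<le> m * j * (int c + 3)"
proof -
  have Hc: "1 \<le> H c" using H_pos by simp
  have j: "j = int c + 2"
  proof (rule j_eqI)
    show "0 < fx (int c + 2)" using Hc last by (simp add: fx_c2)
    show "fx k \<le> 0" if "int c + 2 < k" for k
    proof (cases "k = int c + 3")
      case True
      then show ?thesis using fx_c3 by simp
    next
      case False
      then show ?thesis using that fx_gt[of k] by simp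
    qed
  qed
  have no_c2: "0 \<le> fx k" if "int c + 1 < k" "k < int c + 3" for k
  proof -
    have "k = int c + 2" using that by linarith
    then show ?thesis using Hc last fx_c2 by simp
  qed
  show ?thesis
  proof (cases "fx (int c + 1) < 0")
    case True
    then have "m = int c + 1" using no_c2 by (intro m_eqI) auto
    moreover have "6 * e \<le> (c + 1) * (c + 2) * (c + 3)"
    proof -
      have "{0..c} = {..<c + 1}" by auto
      moreover have "c + 1 + 1 = c + 2" "c + 1 + 2 = c + 3" by simp_all
      ultimately show ?thesis using sum_H_le[of "c + 1"] unfolding e_def by (simp only:)
    qed
    then have "int (6 * e) \<le> int ((c + 1) * (c + 2) * (c + 3))" by (rule of_nat_mono)
    ultimately show ?thesis by (simp add: j algebra_simps)
  next
    case False
    then have f1: "0 \<le> fx (int c + 1)" by simp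
    have "c \<noteq> 1"
    proof
      assume "c = 1"
      then have "int c - 2 < 0" "H (c - 1) = 1" "H c = 3" using H_0 H_1 by simp_all
      moreover from this have "hx (int c - 2) = 0" by (intro hx_neg)
      ultimately show False using f1 by (simp add: fx_c1)
    qed
    then have c2: "2 \<le> c" using c_ge_1 by linarith
    have hx2: "hx (int c - 2) = int (H (c - 2))"
      using hx_int[of "c - 2"] c2 by (simp add: of_nat_diff del: hx_int)
    have "1 \<le> H (c - 2)" using H_pos by simp
    \<comment> \<open>f(c + 1) \<ge> 0 says h_{c-2} \<le> 3 (h_{c-1} - h_c); the left side is
      positive and the difference on the right is at most 1.\<close>
    then have H1: "H (c - 1) = H c + 1" and H2: "H (c - 2) \<le> 3"
      using f1 last by (simp_all add: fx_c1 hx2)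
    have "H c \<noteq> 1"
      using H_dual H1 by auto
    then have s: "2 \<le> H c" using Hc by linarith
    have above: "0 \<le> fx k" if "int c < k" "k < int c + 3" for k
      using no_c2[of k] f1 that by (cases "k = int c + 1") auto
    consider "c = 2" | "c = 3" | "4 \<le> c" using c2 by linarith
    then show ?thesis
    proof cases
      case 1
      then have H: "H 2 = 2" using H1 H_1 by simp
      have "fx 2 < 0" using H by (simp add: fx_2)
      then have "m = 2" using 1 above by (intro m_eqI) auto
      moreover have "{0..c} = {0, 1, 2}" using 1 by auto
      then have "e = 6" using H H_0 H_1 by (simp add: e_def)
      moreover have "int c = 2" using 1 by simp
      ultimately show ?thesis unfolding j by (simp only:) simp
    next
      case 2
      then have H: "H 2 = H 3 + 1" using H1 by simp
      have e: "e = 5 + 2 * H 3" using e_split[of 3] 2 H H_0 H_1 by (simp add: numeral_eq_Suc)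
      have c: "int c = 3" using 2 by simp
      have "H 2 \<le> 6" using H_le[of 2] by (simp add: numeral_eq_Suc)
      show ?thesis
      proof (cases "3 \<le> H 3")
        case True
        then have "fx 3 < 0" using H by (simp add: fx_3)
        then have "m = 3" using 2 above by (intro m_eqI) auto
        then show ?thesis using e H \<open>H 2 \<le> 6\<close> unfolding j c by simp
      next
        case False
        then have H3: "H 3 = 2" using s 2 by simp
        then have f: "fx 2 < 0" "0 < fx 3" using H by (simp_all add: fx_2 fx_3)
        have "0 \<le> fx k" if "2 < k" "k < int c + 3" for k
          using above[of k] f(2) that 2 by (cases "k = 3") auto
        then have "m = 2" using 2 f by (intro m_eqI) auto
        then show ?thesis using e H3 unfolding j c by simp
      qed
    next
      case 3
      have "hx (int c - 3) = int (H (c - 3))" "hx (int c - 1) = int (H (c - 1))"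
        using hx_int[of "c - 3"] hx_int[of "c - 1"] 3 by (simp_all add: of_nat_diff del: hx_int)
      then have fc: "fx (int c) = 3 * int (H (c - 2)) - 2 * int (H c) - 3 - int (H (c - 3))"
        using H1 by (simp add: fx_def hx2)
      have "1 \<le> H (c - 3)" using H_pos by simp
      \<comment> \<open>The known bounds suffice unless h_{c-2} = 3 and h_c = 2. In that case
        h_{c-3} is at least 3: a value at most 2 in degree at least 2 cannot be followed by 3, and
        in degree 1 the value is 3 anyway.\<close>
      have "fx (int c) < 0"
      proof (cases "3 \<le> H c \<or> H (c - 2) \<le> 2")
        case True
        then show ?thesis using fc H2 s \<open>1 \<le> H (c - 3)\<close> by linarith
      next
        case False
        have "3 \<le> H (c - 3)"
        proof (cases "c = 4")
          case True
          then show ?thesis using H_1 by simp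
        next
          case F: False
          have "Suc (c - 3) = c - 2" using 3 by linarith
          then show ?thesis using H_decreasing[of "c - 3"] 3 F False by fastforce
        qed
        then show ?thesis using fc H2 s by linarith
      qed
      then have m: "m = int c" using above by (intro m_eqI) auto
      have "H (c - 1) \<le> 9" using H_growth[of "c - 2"] H2 c2 by (simp add: Suc_diff_le numeral_2_eq_2 flip: Suc_diff_Suc)
      have "e = (\<Sum>d<c - 2. H d) + H (c - 2) + H (c - 1) + H c"
      proof -
        have "(\<Sum>d<Suc (Suc (Suc (c - 2))). H d)
            = (\<Sum>d<c - 2. H d) + H (c - 2) + H (Suc (c - 2)) + H (Suc (Suc (c - 2)))"
          by simp
        moreover have "Suc (c - 2) = c - 1" "Suc (c - 1) = c" "{0..c} = {..<Suc c}" using c2 by auto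
        ultimately show ?thesis unfolding e_def by (simp only:)
      qed
      \<comment> \<open>The last three entries are at most 3, 9 and 8, and 6 (3 + 9 + 8) =
        120.\<close>
      then have "6 * e \<le> 6 * (\<Sum>d<c - 2. H d) + 120"
        using H1 H2 \<open>H (c - 1) \<le> 9\<close> by linarith
      also have "\<dots> \<le> (c - 2) * (c - 1) * c + 120"
      proof -
        have "c - 2 + 1 = c - 1" "c - 2 + 2 = c" using c2 by auto
        then show ?thesis using sum_H_le[of "c - 2"] by simp
      qed
      finally have "int (6 * e) \<le> int ((c - 2) * (c - 1) * c + 120)" by (rule of_nat_mono)
      also have "\<dots> = (int c - 2) * (int c - 1) * int c + 120" using c2 by (simp add: of_nat_diff)
      also have "\<dots> \<le> int c * (int c + 2) * (int c + 3)"
      proof -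
        have "4 * 4 \<le> int c * int c" using 3 by (intro mult_mono) auto
        moreover have "int c * (int c + 2) * (int c + 3) - (int c - 2) * (int c - 1) * int c
          = 8 * (int c * int c) + 4 * int c" by (simp add: algebra_simps)
        ultimately show ?thesis using 3 by linarith
      qed
      finally show ?thesis by (simp add: m j)
    qed
  qed
qed

text \<open>
  With \<open>N d = (2 + d) choose d\<close>, the integer \<open>r\<^sub>d\<close> of a level algebra is \<open>N d - h\<^sub>c N (c - d)\<close>, so the
  last two hypotheses say \<open>r\<^sub>b \<ge> 0 > r\<^bsub>b-1\<^esub>\<close>. In the proof \<open>P\<close> is the polynomial \<open>2 N\<close> on all of \<open>int\<close>;
  as \<open>P (- 1) = P (- 2) = 0\<close>, it agrees with \<open>2 hx\<close> also just below 0.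
\<close>

lemma bounds_if_compressed:
  assumes b: "1 \<le> b" "b \<le> c"
    and H: "\<And>d. d \<le> c \<Longrightarrow> H d = min (H c * ((2 + (c - d)) choose (c - d))) ((2 + d) choose d)"
    and b_le: "H c * ((2 + (c - b)) choose (c - b)) \<le> (2 + b) choose b"
    and b_less: "(2 + (b - 1)) choose (b - 1) < H c * ((2 + (c - (b - 1))) choose (c - (b - 1)))"
  shows "int t * i * (int c + 3) \<le> 6 * int e" "6 * int e \<le> m * j * (int c + 3)"
proof -
  let ?N = "\<lambda>d. (2 + d) choose d"
  define s B u where "s = int (H c)" and "B = int b" and "u = int c - int b"
  have pos: "1 \<le> s" "1 \<le> B" "0 \<le> u" using b H_pos[of c] by (simp_all add: s_def B_def u_def)
  have c_eq: "int c = u + B" by (simp add: u_def B_def)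
  have N_mono: "?N d \<le> ?N d'" if "d \<le> d'" for d d' :: nat
  proof -
    have "2 * ?N d \<le> 2 * ?N d'" unfolding double_choose using that by (intro mult_mono) auto
    then show ?thesis by simp
  qed
  have low: "H d = ?N d" if "d < b" for d
  proof -
    have "?N d \<le> ?N (b - 1)" using that by (intro N_mono) simp
    also have "\<dots> \<le> H c * ?N (c - (b - 1))" using b_less by simp
    also have "\<dots> \<le> H c * ?N (c - d)" using that by (intro mult_left_mono N_mono) auto
    finally show ?thesis using H[of d] that b by simp
  qed
  have high: "H d = H c * ?N (c - d)" if "b \<le> d" "d \<le> c" for d
  proof -
    have "H c * ?N (c - d) \<le> H c * ?N (c - b)" using that by (intro mult_left_mono N_mono) auto
    also have "\<dots> \<le> ?N d" using b_le N_mono[OF that(1)] by linarith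
    finally show ?thesis using H[OF that(2)] by simp
  qed
  define P where "P x = (x + 1) * (x + 2)" for x :: int
  have P_nat: "2 * int (?N d) = P (int d)" for d
  proof -
    have "int (2 * ?N d) = int ((d + 1) * (d + 2))" by (simp only: double_choose)
    then show ?thesis by (simp add: P_def algebra_simps)
  qed
  have hx_low: "2 * hx n = P n" if "- 3 < n" "n < B" for n
  proof -
    have "n = - 2 \<or> n = - 1 \<or> 0 \<le> n" using that by presburger
    then consider "n = - 2" | "n = - 1" | "0 \<le> n" by blast
    then show ?thesis
    proof cases
      case 3
      then obtain d where "n = int d" using zero_le_imp_eq_int by blast
      then show ?thesis using that low[of d] P_nat[of d] by (simp add: B_def)
    qed (simp_all add: P_def)
  qed
  have hx_high: "2 * hx n = s * P (int c - n)" if "B \<le> n" "n < int c + 3" for n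
  proof -
    have "n = int c + 1 \<or> n = int c + 2 \<or> n \<le> int c" using that by presburger
    then consider "n = int c + 1" | "n = int c + 2" | "n \<le> int c" by blast
    then show ?thesis
    proof cases
      case 3
      have "0 \<le> n" using that pos by linarith
      then obtain d where d: "n = int d" using zero_le_imp_eq_int by blast
      then have "b \<le> d" "d \<le> c" using that 3 by (simp_all add: B_def)
      then have "2 * hx n = s * (2 * int (?N (c - d)))" using d high[of d] by (simp add: s_def)
      then show ?thesis unfolding P_nat using d \<open>d \<le> c\<close> by (simp add: of_nat_diff)
    qed (simp_all add: hx_gt P_def)
  qed
  have fx2: "2 * fx n = 2 * hx n - 3 * (2 * hx (n - 1)) + 3 * (2 * hx (n - 2)) - 2 * hx (n - 3)" for n
    by (simp add: fx_def)
  \<comment> \<open>Third differences of a quadratic polynomial vanish; all four indices lie on the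
    low branch, and in \<open>f_mid\<close> all four lie on the high one.\<close>
  have f_low: "fx n = 0" if "0 < n" "n < B" for n
  proof -
    have "2 * fx n = P n - 3 * P (n - 1) + 3 * P (n - 2) - P (n - 3)"
      unfolding fx2 using that by (simp add: hx_low)
    also have "\<dots> = 0" by (simp add: P_def algebra_simps)
    finally show ?thesis by simp
  qed
  have f_b: "2 * fx B = s * P u - P B"
  proof -
    have "2 * fx B = s * P (int c - B) - 3 * P (B - 1) + 3 * P (B - 2) - P (B - 3)"
      unfolding fx2 using pos c_eq by (simp add: hx_low hx_high)
    then show ?thesis by (simp add: c_eq P_def algebra_simps)
  qed
  have f_b1: "2 * fx (B + 1) = 2 * B * (B + 2) - 2 * s * (u + 1) * (u + 3)"
  proof -
    have "2 * fx (B + 1) = s * P (int c - (B + 1)) - 3 * (s * P (int c - B)) + 3 * P (B - 1) - P (B - 2)"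
      unfolding fx2 using pos c_eq by (simp add: hx_low hx_high)
    then show ?thesis by (simp add: c_eq P_def algebra_simps)
  qed
  have f_b2: "2 * fx (B + 2) = s * P (u + 1) - P (B - 1)"
  proof -
    have "2 * fx (B + 2) = s * P (int c - (B + 2)) - 3 * (s * P (int c - (B + 1)))
        + 3 * (s * P (int c - B)) - P (B - 1)"
      unfolding fx2 using pos c_eq by (simp add: hx_low hx_high)
    then show ?thesis by (simp add: c_eq P_def algebra_simps)
  qed
  have f_mid: "fx n = 0" if "B + 2 < n" "n < int c + 3" for n
  proof -
    have "2 * fx n = s * P (int c - n) - 3 * (s * P (int c - (n - 1)))
        + 3 * (s * P (int c - (n - 2))) - s * P (int c - (n - 3))"
      unfolding fx2 using that pos by (simp add: hx_high)
    also have "\<dots> = 0" by (simp add: P_def algebra_simps)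
    finally show ?thesis by simp
  qed
  have f_high: "fx n \<le> 0" if "B + 2 < n" for n
  proof -
    consider "n < int c + 3" | "n = int c + 3" | "int c + 3 < n" by linarith
    then show ?thesis
      by cases (simp_all add: f_mid that fx_c3 fx_gt)
  qed
  have g_b: "s * P u \<le> P B"
  proof -
    have "int (2 * (H c * ?N (c - b))) \<le> int (2 * ?N b)" using b_le by (intro of_nat_mono) simp
    then have "s * (2 * int (?N (c - b))) \<le> 2 * int (?N b)" by (simp add: s_def algebra_simps)
    then show ?thesis unfolding P_nat using b(2) by (simp add: u_def B_def of_nat_diff)
  qed
  have g_b1: "P (B - 1) < s * P (u + 1)"
  proof -
    have "int (2 * ?N (b - 1)) < int (2 * (H c * ?N (c - (b - 1))))"
      using b_less by (simp only: of_nat_less_iff)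
    then have "2 * int (?N (b - 1)) < s * (2 * int (?N (c - (b - 1))))" by (simp add: s_def algebra_simps)
    then show ?thesis unfolding P_nat using b by (simp add: u_def B_def of_nat_diff algebra_simps)
  qed
  have f2_pos: "0 < fx (B + 2)" using f_b2 g_b1 by simp
  have fb_le: "fx B \<le> 0" using f_b g_b by simp
  have j: "j = B + 2" using f2_pos f_high by (rule j_eqI)
  have e6: "6 * int e = B * (B + 1) * (B + 2) + s * ((u + 1) * (u + 2) * (u + 3))"
  proof -
    have "(\<Sum>d<b. H d) = (\<Sum>d<b. ?N d)" by (simp add: low)
    then have 1: "6 * (\<Sum>d<b. H d) = b * (b + 1) * (b + 2)" by (simp only: sum_choose)
    have "(\<Sum>d=b..c. H d) = (\<Sum>d=b..c. H c * ?N (c - d))" by (intro sum.cong refl high) auto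
    also have "\<dots> = (\<Sum>d<c - b + 1. H c * ?N d)"
      using b(2) by (rule sum_reflect)
    also have "\<dots> = H c * (\<Sum>d<c - b + 1. ?N d)" by (rule sum_distrib_left[symmetric])
    finally have "6 * (\<Sum>d=b..c. H d) = H c * (6 * (\<Sum>d<c - b + 1. ?N d))" by (simp only: mult.left_commute)
    also have "\<dots> = H c * ((c - b + 1) * (c - b + 1 + 1) * (c - b + 1 + 2))"
      by (simp only: sum_choose)
    finally have "6 * e = b * (b + 1) * (b + 2) + H c * ((c - b + 1) * (c - b + 1 + 1) * (c - b + 1 + 2))"
      using 1 by (simp only: e_split[OF b(2)] distrib_left)
    then have "int (6 * e) = int (b * (b + 1) * (b + 2) + H c * ((c - b + 1) * (c - b + 1 + 1) * (c - b + 1 + 2)))"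
      by (simp only:)
    then have "6 * int e = B * (B + 1) * (B + 2) + s * ((u + 1) * (u + 1 + 1) * (u + 1 + 2))"
      unfolding s_def B_def u_def of_nat_diff[OF b(2), symmetric]
      by (simp only: of_nat_mult of_nat_add of_nat_numeral of_nat_1)
    moreover have "u + 1 + 1 = u + 2" "u + 1 + 2 = u + 3" by simp_all
    ultimately show ?thesis by (simp only:)
  qed
  have c3: "int c + 3 = u + B + 3" by (simp add: c_eq)
  \<comment> \<open>By \<open>e6\<close>, the four bounds amount to comparing s (u + 1) (u + 2) (u +
    3) with (B + 1) (B + 2) (u + 3), B (B + 2) (u + 2) or B (B + 1) (u + 1). These comparisons are
    the signs of f at B, B + 1 and B + 2, multiplied by the factor u + 3, u + 2 or u + 1.\<close>
  have upper0: "6 * int e \<le> (B + 1) * (B + 2) * (int c + 3)"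
  proof -
    have "s * P u * (u + 3) \<le> P B * (u + 3)" using g_b pos by (intro mult_right_mono) auto
    then show ?thesis unfolding e6 c3 by (simp add: P_def algebra_simps)
  qed
  have upper1: "6 * int e \<le> B * (B + 2) * (int c + 3)" if "0 \<le> fx (B + 1)"
  proof -
    have "s * (u + 1) * (u + 3) \<le> B * (B + 2)" using that f_b1 by (simp add: algebra_simps)
    then have "s * (u + 1) * (u + 3) * (u + 2) \<le> B * (B + 2) * (u + 2)"
      using pos by (intro mult_right_mono) auto
    then show ?thesis unfolding e6 c3 by (simp add: algebra_simps)
  qed
  have lower0: "B * (B + 1) * (int c + 3) \<le> 6 * int e"
  proof -
    have "P (B - 1) * (u + 1) \<le> s * P (u + 1) * (u + 1)"
      using g_b1 pos by (intro mult_right_mono) auto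
    then show ?thesis unfolding e6 c3 by (simp add: P_def algebra_simps)
  qed
  have lower1: "B * (B + 2) * (int c + 3) \<le> 6 * int e" if "fx (B + 1) \<le> 0"
  proof -
    have "B * (B + 2) \<le> s * (u + 1) * (u + 3)" using that f_b1 by (simp add: algebra_simps)
    then have "B * (B + 2) * (u + 2) \<le> s * (u + 1) * (u + 3) * (u + 2)"
      using pos by (intro mult_right_mono) auto
    then show ?thesis unfolding e6 c3 by (simp add: algebra_simps)
  qed
  \<comment> \<open>In the tie f(B) = 0 the first negative value has to come at B + 1. Substituting
    s P(u) = P(B) leaves the sign of B (u + 2) - (B + 1) (u + 3).\<close>
  have f_b1_neg: "fx (B + 1) < 0" if "fx B = 0"
  proof -
    have eq: "s * P u = P B" using f_b that by simp
    have "2 * fx (B + 1) * (u + 2) = 2 * B * (B + 2) * (u + 2) - 2 * (s * P u) * (u + 3)"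
      unfolding f_b1 by (simp add: P_def algebra_simps)
    also have "\<dots> = 2 * (B + 2) * (B * (u + 2) - (B + 1) * (u + 3))"
      unfolding eq by (simp add: P_def algebra_simps)
    also have "\<dots> < 0" using pos by (intro mult_pos_neg) (auto simp: algebra_simps)
    finally show ?thesis using pos by (simp add: mult_less_0_iff)
  qed
  have m_le: "6 * int e \<le> m * j * (int c + 3)"
  proof (cases "fx (B + 1) < 0")
    case True
    have "0 \<le> fx k" if "B + 1 < k" "k < int c + 3" for k
      using f2_pos f_mid[of k] that by (cases "k = B + 2") auto
    then have "m = B + 1" using True pos c_eq by (intro m_eqI) auto
    then show ?thesis using upper0 by (simp add: j)
  next
    case False
    then have "fx B < 0" using f_b1_neg fb_le by fastforce
    moreover have "0 \<le> fx k" if "B < k" "k < int c + 3" for k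
      using f2_pos f_mid[of k] that False by (cases "k = B + 2"; cases "k = B + 1") auto
    ultimately have "m = B" using pos c_eq by (intro m_eqI) auto
    then show ?thesis using upper1 False by (simp add: j)
  qed
  have le_i: "fx k \<le> 0" if "0 < k" "k < B + 1" for k
    using f_low[of k] fb_le that by (cases "k = B") auto
  \<comment> \<open>In the tie, h_b is still maximal, so t = b + 1 and i = b + 2, and the bound is
    an equality. Otherwise t = b, and the sign of f(B + 1) decides between i = b + 1 and i = b +
    2.\<close>
  have t_i: "int t * i * (int c + 3) \<le> 6 * int e"
  proof (cases "fx B = 0")
    case True
    have f1: "fx (B + 1) < 0" using f_b1_neg[OF True] .
    have i: "i = B + 2"
    proof (rule i_eqI)
      show "fx k \<le> 0" if "0 < k" "k < B + 2" for k
        using le_i[of k] f1 that by (cases "k = B + 1") auto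
    qed (use f2_pos pos in auto)
    have Hb: "H b = ?N b"
    proof -
      have "2 * hx B = P B" using hx_high[of B] f_b True pos c_eq by simp
      then show ?thesis using P_nat[of b] by (simp add: B_def)
    qed
    have "t = b + 1"
    proof (rule t_eqI)
      show "H k = ?N k" if "k < b + 1" for k
        using low[of k] Hb that by (cases "k = b") auto
      have "2 * hx (B + 1) < P (B + 1)"
      proof -
        have "2 * fx (B + 1) = 2 * hx (B + 1) - 3 * P B + 3 * P (B - 1) - P (B - 2)"
          unfolding fx2 using pos hx_low[of "B - 1"] hx_low[of "B - 2"] Hb P_nat[of b]
          by (simp add: B_def)
        then show ?thesis using f1 by (simp add: P_def algebra_simps)
      qed
      moreover have "hx (B + 1) = int (H (b + 1))" using hx_int[of "b + 1"] by (simp add: B_def add.commute del: hx_int)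
      moreover have "P (B + 1) = 2 * int (?N (b + 1))" unfolding P_nat by (simp add: B_def add.commute)
      ultimately show "H (b + 1) < ?N (b + 1)" by (simp del: binomial_Suc_Suc)
    qed
    moreover have "(B + 1) * (B + 2) * (int c + 3) = 6 * int e"
    proof -
      have "s * P u = P B" using f_b True by simp
      then have "s * P u * (u + 3) = P B * (u + 3)" by simp
      then show ?thesis unfolding e6 c3 by (simp add: P_def algebra_simps)
    qed
    ultimately show ?thesis by (simp add: i B_def algebra_simps)
  next
    case False
    then have fb: "fx B < 0" using fb_le by simp
    have "t = b"
    proof (rule t_eqI)
      have "2 * hx B < P B" using hx_high[of B] f_b fb pos c_eq by simp
      then show "H b < ?N b" using P_nat[of b] by (simp add: B_def)
    qed (rule low)
    then have t: "int t = B" by (simp add: B_def)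
    show ?thesis
    proof (cases "0 < fx (B + 1)")
      case True
      then have "i = B + 1" using le_i pos by (intro i_eqI) auto
      then show ?thesis using lower0 by (simp add: t)
    next
      case False
      have "i = B + 2"
      proof (rule i_eqI)
        show "fx k \<le> 0" if "0 < k" "k < B + 2" for k
          using le_i[of k] False that by (cases "k = B + 1") auto
      qed (use f2_pos pos in auto)
      then show ?thesis using lower1 False by (simp add: t)
    qed
  qed
  show "int t * i * (int c + 3) \<le> 6 * int e" "6 * int e \<le> m * j * (int c + 3)"
    using t_i m_le by auto
qed

end

section \<open>The quotient ring\<close>

lemma poly_ring_simps [simp]:
  "carrier poly_ring = UNIV" "x \<otimes>\<^bsub>poly_ring\<^esub> y = x * y" "x \<oplus>\<^bsub>poly_ring\<^esub> y = x + y"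
  "\<one>\<^bsub>poly_ring\<^esub> = 1" "\<zero>\<^bsub>poly_ring\<^esub> = 0"
  for x y :: "('n, 'k::field) mpoly"
  by (simp_all add: ring_of_type_algebra_def)

lemma ring_poly_ring: "ring (poly_ring :: ('n, 'k::field) mpoly ring)"
  by (rule ring_from_type_algebra)

lemma ideal_poly_ringI:
  fixes J :: "('n, 'k::field) mpoly set"
  assumes "0 \<in> J" "\<And>p q. p \<in> J \<Longrightarrow> q \<in> J \<Longrightarrow> p + q \<in> J" "\<And>p q. p \<in> J \<Longrightarrow> q * p \<in> J"
  shows "ideal J poly_ring"
proof (rule idealI)
  interpret R: ring "poly_ring :: ('n, 'k) mpoly ring" by (rule ring_poly_ring)
  show "subgroup J (add_monoid poly_ring)"
  proof (rule group.subgroupI)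
    show "inv\<^bsub>add_monoid poly_ring\<^esub> p \<in> J" if "p \<in> J" for p
    proof -
      have "\<ominus>\<^bsub>poly_ring\<^esub> p = - p" by (rule R.minus_equality) simp_all
      then have "inv\<^bsub>add_monoid poly_ring\<^esub> p = - 1 * p" by (simp add: a_inv_def)
      then show ?thesis using assms(3)[OF that, of "- 1"] by simp
    qed
  qed (use assms R.a_group in auto)
  show "p \<otimes>\<^bsub>poly_ring\<^esub> q \<in> J" if "p \<in> J" for p q
    using assms(3)[OF that, of q] by (simp add: mult.commute)
qed (use assms ring_poly_ring in auto)

lemma graded_ideal_if_homogeneous:
  fixes I :: "('n::finite, 'k::field) mpoly set"
  assumes "homogeneous_ideal I"
  shows "graded_ideal I"
proof -
  interpret R: ring "poly_ring :: ('n, 'k) mpoly ring" by (rule ring_poly_ring)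
  obtain F where F: "F \<subseteq> (\<Union>d. forms d)" "I = Idl\<^bsub>poly_ring\<^esub> F"
    using assms by (auto simp: homogeneous_ideal_def)
  interpret I: ideal I poly_ring unfolding F(2) by (rule R.genideal_ideal) simp
  have zero: "0 \<in> I" using I.zero_closed by simp
  have add: "p + q \<in> I" if "p \<in> I" "q \<in> I" for p q using I.a_closed[OF that] by simp
  have mult: "q * p \<in> I" if "p \<in> I" for p q using I.I_l_closed[OF that, of q] by simp
  \<comment> \<open>The elements of \<open>I\<close> all of whose components lie in \<open>I\<close>
    form an ideal containing the generators, hence are all of \<open>I\<close>.\<close>
  define J where "J = {p \<in> I. \<forall>d. hom_comp d p \<in> I}"
  have sum: "(\<Sum>x\<in>A. f x) \<in> I" if "\<And>x. x \<in> A \<Longrightarrow> f x \<in> I" for f :: "nat \<Rightarrow> _" and A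
    using that by (induction A rule: infinite_finite_induct) (auto intro: zero add)
  have "ideal J poly_ring"
  proof (rule ideal_poly_ringI)
    show "0 \<in> J" by (simp add: J_def zero)
    show "p + q \<in> J" if "p \<in> J" "q \<in> J" for p q
      using that by (simp add: J_def add hom_comp_add)
    show "q * p \<in> J" if p: "p \<in> J" for p q
    proof -
      have "hom_comp d (q * p) \<in> I" for d
      proof -
        have "q * p = (\<Sum>a\<in>mon_degree ` Poly_Mapping.keys q. \<Sum>b\<in>mon_degree ` Poly_Mapping.keys p.
            hom_comp a q * hom_comp b p)"
          by (subst sum_hom_comp[of q], subst sum_hom_comp[of p]) (rule sum_product)
        then have "hom_comp d (q * p) = (\<Sum>a\<in>mon_degree ` Poly_Mapping.keys q.
            \<Sum>b\<in>mon_degree ` Poly_Mapping.keys p. hom_comp d (hom_comp a q * hom_comp b p))"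
          by (simp only: hom_comp_sum)
        moreover have "hom_comp d (hom_comp a q * hom_comp b p) \<in> I" for a b
          using p by (simp add: J_def hom_comp_form[OF forms_mult[OF hom_comp_in_forms hom_comp_in_forms]] zero mult)
        ultimately show ?thesis by (simp add: sum)
      qed
      then show ?thesis using p by (simp add: J_def mult)
    qed
  qed
  moreover have "F \<subseteq> J"
  proof
    fix p assume "p \<in> F"
    then obtain e where "p \<in> forms e" "p \<in> I" using F R.genideal_self[of F] by auto
    then show "p \<in> J" by (simp add: J_def hom_comp_form zero)
  qed
  ultimately have "I \<subseteq> J" using R.genideal_minimal[of J F] F(2) by simp
  then show ?thesis by unfold_locales (auto simp: J_def zero add mult)
qed

section \<open>Cosets, dimensions over the scalars, and the socle of the quotient\<close>

context graded_ideal
begin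

lemma ideal_axiom: "ideal I poly_ring"
  by (rule ideal_poly_ringI) (rule zero_mem add_mem mult_mem; assumption)+

lemma residue_class_eq: "residue_class I p = (\<lambda>i. i + p) ` I"
  by (auto simp: residue_class_def a_r_coset_def')

lemma residue_class_eq_iff: "residue_class I p = residue_class I q \<longleftrightarrow> p - q \<in> I"
proof
  assume "residue_class I p = residue_class I q"
  moreover have "p \<in> residue_class I p" using zero_mem by (force simp: residue_class_eq)
  ultimately show "p - q \<in> I" by (auto simp: residue_class_eq)
next
  assume pq: "p - q \<in> I"
  then have qp: "q - p \<in> I" using neg_mem by fastforce
  show "residue_class I p = residue_class I q"
    unfolding residue_class_eq
  proof (intro subset_antisym subsetI)
    fix r assume "r \<in> (\<lambda>i. i + p) ` I"
    then obtain i where "i \<in> I" "r = i + p" by blast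
    then have "r = (i + (p - q)) + q" "i + (p - q) \<in> I" using add_mem[OF _ pq] by simp_all
    then show "r \<in> (\<lambda>i. i + q) ` I" by blast
  next
    fix r assume "r \<in> (\<lambda>i. i + q) ` I"
    then obtain i where "i \<in> I" "r = i + q" by blast
    then have "r = (i + (q - p)) + p" "i + (q - p) \<in> I" using add_mem[OF _ qp] by simp_all
    then show "r \<in> (\<lambda>i. i + p) ` I" by blast
  qed
qed

lemma residue_class_proj [simp]: "residue_class I (proj p) = residue_class I p"
  by (simp add: residue_class_eq_iff proj_diff_mem)

lemma ring_quot_alg: "ring (quot_alg I)"
  unfolding quot_alg_def by (rule ideal.quotient_is_ring[OF ideal_axiom])

lemma carrier_quot_alg: "carrier (quot_alg I) = range (residue_class I)"
  by (auto simp: quot_alg_def FactRing_def A_RCOSETS_def' residue_class_def)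

lemma residue_class_hom: "residue_class I \<in> ring_hom poly_ring (quot_alg I)"
  using ideal.rcos_ring_hom[OF ideal_axiom] unfolding quot_alg_def residue_class_def .

lemma residue_class_ops:
  "residue_class I p \<otimes>\<^bsub>quot_alg I\<^esub> residue_class I q = residue_class I (p * q)"
  "residue_class I p \<oplus>\<^bsub>quot_alg I\<^esub> residue_class I q = residue_class I (p + q)"
  "\<one>\<^bsub>quot_alg I\<^esub> = residue_class I 1"
  using ring_hom_memE[OF residue_class_hom] by auto

lemma zero_quot_alg: "\<zero>\<^bsub>quot_alg I\<^esub> = residue_class I 0"
  by (simp add: quot_alg_def FactRing_def residue_class_eq)

lemma residue_class_hom_ring: "ring_hom_ring poly_ring (quot_alg I) (residue_class I)"
  by (rule ring_hom_ringI2[OF ring_poly_ring ring_quot_alg residue_class_hom])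

text \<open>Nonzero constants are units, and \<open>1 \<notin> I\<close> keeps one and zero apart in
  the quotient. This licenses dimensions over \<open>scalars I\<close>.\<close>

lemma subfield_scalars:
  assumes "1 \<notin> I"
  shows "subfield (scalars I) (quot_alg I)"
proof -
  interpret R: cring "poly_ring :: ('n, 'k) mpoly ring" by (rule cring_from_type_algebra)
  have sub: "subcring (range (Poly_Mapping.single 0)) (poly_ring :: ('n, 'k) mpoly ring)"
  proof (rule R.subcringI')
    show "subring (range (Poly_Mapping.single 0)) (poly_ring :: ('n, 'k) mpoly ring)"
    proof (rule R.subringI)
      show "\<ominus>\<^bsub>poly_ring\<^esub> h \<in> range (Poly_Mapping.single 0)"
        if h: "h \<in> range (Poly_Mapping.single 0)" for h :: "('n, 'k) mpoly"
      proof -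
        have "\<ominus>\<^bsub>poly_ring\<^esub> h = - h" by (rule R.minus_equality) simp_all
        then show ?thesis using h by (auto simp flip: single_uminus)
      qed
    qed (auto simp: mult_single simp flip: single_add single_one)
  qed
  have "Units (poly_ring \<lparr> carrier := range (Poly_Mapping.single 0) \<rparr>)
      = range (Poly_Mapping.single 0) - {\<zero>\<^bsub>poly_ring :: ('n, 'k) mpoly ring\<^esub>}"
  proof (intro subset_antisym subsetI)
    fix p :: "('n, 'k) mpoly"
    assume "p \<in> Units (poly_ring \<lparr> carrier := range (Poly_Mapping.single 0) \<rparr>)"
    then show "p \<in> range (Poly_Mapping.single 0) - {\<zero>\<^bsub>poly_ring\<^esub>}"
      by (auto simp: Units_def)
  next
    fix p :: "('n, 'k) mpoly"
    assume "p \<in> range (Poly_Mapping.single 0) - {\<zero>\<^bsub>poly_ring\<^esub>}"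
    then obtain a where "p = Poly_Mapping.single 0 a" "p \<noteq> 0" by auto
    then have a: "p = Poly_Mapping.single 0 a" "a \<noteq> 0" by auto
    then have "Poly_Mapping.single 0 (inverse a) * p = 1" "p * Poly_Mapping.single 0 (inverse a) = 1"
      by (simp_all add: mult_single)
    then show "p \<in> Units (poly_ring \<lparr> carrier := range (Poly_Mapping.single 0) \<rparr>)"
      using a by (auto simp: Units_def)
  qed
  then have "subfield (range (Poly_Mapping.single 0)) (poly_ring :: ('n, 'k) mpoly ring)"
    by (rule R.subfieldI[OF sub])
  then show ?thesis
    unfolding scalars_def
  proof (rule ring_hom_ring.img_is_subfield(2)[OF residue_class_hom_ring])
    show "\<one>\<^bsub>quot_alg I\<^esub> \<noteq> \<zero>\<^bsub>quot_alg I\<^esub>"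
      using assms by (simp add: residue_class_ops zero_quot_alg residue_class_eq_iff)
  qed
qed

text \<open>\<open>proj\<close> fixes its range and kills exactly \<open>I\<close>, so distinct
  vectors of the range have distinct residue classes. Independence therefore survives in the
  quotient, and each vector of the list adds one proper line extension.\<close>

lemma dimension_span:
  assumes "mp.independent (set ws)" "distinct ws" "set ws \<subseteq> range proj"
  shows "ring.dimension (quot_alg I) (length ws) (scalars I) (residue_class I ` mp.span (set ws))"
  using assms
proof (induction ws)
  case Nil
  interpret Q: ring "quot_alg I" by (rule ring_quot_alg)
  show ?case using Q.zero_dim by (simp add: zero_quot_alg)
next
  case (Cons w ws)
  interpret Q: ring "quot_alg I" by (rule ring_quot_alg)
  let ?E = "residue_class I ` mp.span (set ws)"
  have w: "w \<notin> mp.span (set ws)"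
    using Cons.prems(1,2) by (simp add: mp.independent_insert)
  have ind: "mp.independent (set ws)" using Cons.prems(1) mp.independent_mono by (metis set_subset_Cons)
  have sub: "mp.span (set ws) \<subseteq> range proj"
    using Cons.prems(3) by (intro mp.span_minimal proj.subspace_image mp.subspace_UNIV) auto
  have "residue_class I w \<notin> ?E"
  proof
    assume "residue_class I w \<in> ?E"
    then obtain v where v: "v \<in> mp.span (set ws)" "w - v \<in> I"
      by (auto simp: residue_class_eq_iff)
    obtain p q where "v = proj p" "w = proj q" using v(1) sub Cons.prems(3) by auto
    then have "w - v = proj (w - v)"
      using proj_mult_proj[of 1] by (simp add: proj.diff)
    then have "w = v" using v(2) proj_eq_0_iff[of "w - v"] by simp
    then show False using v w by simp
  qed
  then have "Q.dimension (Suc (length ws)) (scalars I) (Q.line_extension (scalars I) (residue_class I w) ?E)"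
    using Cons ind by (intro Q.Suc_dim) (simp_all add: carrier_quot_alg)
  moreover have "Q.line_extension (scalars I) (residue_class I w) ?E = residue_class I ` mp.span (set (w # ws))"
  proof (intro subset_antisym subsetI)
    fix u assume "u \<in> Q.line_extension (scalars I) (residue_class I w) ?E"
    then obtain a v where "v \<in> mp.span (set ws)" "u = residue_class I (scale_poly a w + v)"
      by (auto simp: Q.line_extension_mem_iff scalars_def residue_class_ops scale_poly_def)
    moreover from this have "scale_poly a w + v \<in> mp.span (set (w # ws))"
      by (auto simp: mp.span_insert intro: exI[of _ a])
    ultimately show "u \<in> residue_class I ` mp.span (set (w # ws))" by blast
  next
    fix u assume "u \<in> residue_class I ` mp.span (set (w # ws))"
    then obtain v a where v: "u = residue_class I v" "v - scale_poly a w \<in> mp.span (set ws)"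
      by (auto simp: mp.span_insert)
    then have "u = residue_class I (Poly_Mapping.single 0 a) \<otimes>\<^bsub>quot_alg I\<^esub> residue_class I w
        \<oplus>\<^bsub>quot_alg I\<^esub> residue_class I (v - scale_poly a w)"
      by (simp add: residue_class_ops scale_poly_def)
    then show "u \<in> Q.line_extension (scalars I) (residue_class I w) ?E"
      unfolding Q.line_extension_mem_iff scalars_def using v(2) by blast
  qed
  ultimately show ?case by simp
qed

text \<open>The bridge between the two dimensions: \<open>V\<close> and its image under
  \<open>proj\<close> have the same cosets, and a basis of that image meets the conditions of
  \<open>dimension_span\<close>.\<close>

lemma dim_k_eq:
  assumes "1 \<notin> I" "mp.subspace V" "finite T" "V \<subseteq> mp.span T"
  shows "dim_k I (residue_class I ` V) = mp.dim (proj ` V)"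
proof -
  interpret Q: ring "quot_alg I" by (rule ring_quot_alg)
  have "finite (proj ` T)" "proj ` V \<subseteq> mp.span (proj ` T)"
    using assms(3,4) by (auto simp: proj.span_image)
  then obtain B where B: "B \<subseteq> proj ` V" "finite B" "mp.independent B" "proj ` V \<subseteq> mp.span B"
    "card B = mp.dim (proj ` V)"
    using mp.finite_basis_exists by metis
  obtain ws where ws: "set ws = B" "distinct ws" using finite_distinct_list[OF B(2)] by blast
  have "mp.span B = proj ` V"
    using B by (intro subset_antisym mp.span_minimal proj.subspace_image assms(2))
  moreover have "residue_class I ` proj ` V = residue_class I ` V"
    by (simp add: image_image)
  moreover have "Q.dimension (length ws) (scalars I) (residue_class I ` mp.span (set ws))"
    using B(1,3) ws by (intro dimension_span) auto
  ultimately have "Q.dimension (length ws) (scalars I) (residue_class I ` V)"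
    by (simp add: ws)
  then have "dim_k I (residue_class I ` V) = length ws"
    using Q.dimI[OF subfield_scalars[OF assms(1)]] by (simp add: dim_k_def over_def)
  then show ?thesis using B(5) ws distinct_card by metis
qed

lemma h_vector_eq_hilb:
  assumes "1 \<notin> I"
  shows "h_vector I d = hilb d"
  unfolding h_vector_def component_def hilb_def piece_def
  by (rule dim_k_eq[OF assms subspace_forms finite_monomials forms_subset_span_monomials])

lemma component_eq_zero_iff: "component I d = {\<zero>\<^bsub>quot_alg I\<^esub>} \<longleftrightarrow> forms d \<subseteq> I"
proof
  assume eq: "component I d = {\<zero>\<^bsub>quot_alg I\<^esub>}"
  show "forms d \<subseteq> I"
  proof
    fix p :: "('n, 'k) mpoly" assume "p \<in> forms d"
    then have "residue_class I p \<in> component I d" unfolding component_def by (rule imageI)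
    then show "p \<in> I" unfolding eq zero_quot_alg by (simp add: residue_class_eq_iff)
  qed
next
  assume sub: "forms d \<subseteq> I"
  have "residue_class I p = residue_class I 0" if "p \<in> forms d" for p
    using sub that by (auto simp: residue_class_eq_iff)
  moreover have "residue_class I 0 \<in> component I d" unfolding component_def by (rule imageI[OF forms_0])
  ultimately show "component I d = {\<zero>\<^bsub>quot_alg I\<^esub>}"
    unfolding zero_quot_alg component_def by blast
qed

lemma forms_subset_Suc:
  assumes "forms d \<subseteq> I"
  shows "forms (Suc d) \<subseteq> I"
proof
  fix p :: "('n, 'k) mpoly" assume "p \<in> forms (Suc d)"
  then show "p \<in> I"
    by (induction p rule: forms_Suc_induct) (use assms zero_mem add_mem mult_mem in auto)
qed

lemma forms_subset_mono:
  assumes "forms d \<subseteq> I" "d \<le> d'"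
  shows "forms d' \<subseteq> I"
  using assms(2) by (induction d' rule: dec_induct) (use assms(1) forms_subset_Suc in blast)+

lemma ideal_residue_class_image:
  assumes "ideal J poly_ring"
  shows "ideal (residue_class I ` J) (quot_alg I)"
proof -
  interpret R: ring "poly_ring :: ('n, 'k) mpoly ring" by (rule ring_poly_ring)
  interpret J: ideal J poly_ring by fact
  interpret Q: ring "quot_alg I" by (rule ring_quot_alg)
  show ?thesis
  proof (rule idealI[OF ring_quot_alg])
    show "subgroup (residue_class I ` J) (add_monoid (quot_alg I))"
    proof (rule group.subgroupI[OF Q.a_group])
      show "residue_class I ` J \<subseteq> carrier (add_monoid (quot_alg I))"
        by (auto simp: carrier_quot_alg)
      show "residue_class I ` J \<noteq> {}" using J.zero_closed by blast
      show "a \<otimes>\<^bsub>add_monoid (quot_alg I)\<^esub> b \<in> residue_class I ` J"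
        if ab: "a \<in> residue_class I ` J" "b \<in> residue_class I ` J" for a b
      proof -
        obtain p q where "p \<in> J" "q \<in> J" "a = residue_class I p" "b = residue_class I q" using ab by blast
        then show ?thesis using J.a_closed[of p q] by (simp add: residue_class_ops)
      qed
      show "inv\<^bsub>add_monoid (quot_alg I)\<^esub> a \<in> residue_class I ` J" if "a \<in> residue_class I ` J" for a
      proof -
        obtain p where p: "p \<in> J" "a = residue_class I p" using \<open>a \<in> residue_class I ` J\<close> by blast
        have "\<ominus>\<^bsub>quot_alg I\<^esub> a = residue_class I (- 1 * p)"
          by (rule Q.minus_equality) (simp_all add: p residue_class_ops zero_quot_alg carrier_quot_alg)
        moreover have "- 1 * p \<in> J" using J.I_l_closed[OF p(1), of "- 1"] by simp
        ultimately show ?thesis by (simp add: a_inv_def)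
      qed
    qed
    show "x \<otimes>\<^bsub>quot_alg I\<^esub> a \<in> residue_class I ` J" "a \<otimes>\<^bsub>quot_alg I\<^esub> x \<in> residue_class I ` J"
      if ax: "a \<in> residue_class I ` J" "x \<in> carrier (quot_alg I)" for a x
    proof -
      obtain p q where pq: "p \<in> J" "a = residue_class I p" "x = residue_class I q"
        using ax by (auto simp: carrier_quot_alg)
      then have "q * p \<in> J" "p * q \<in> J"
        using J.I_l_closed[OF pq(1), of q] J.I_r_closed[OF pq(1), of q] by simp_all
      then show "x \<otimes>\<^bsub>quot_alg I\<^esub> a \<in> residue_class I ` J" "a \<otimes>\<^bsub>quot_alg I\<^esub> x \<in> residue_class I ` J"
        using pq by (auto simp: residue_class_ops)
    qed
  qed
qed

text \<open>The chain condition is applied to the polynomials of order at least n. Once the chain is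
  stable at \<open>N\<close>, a form of degree \<open>N\<close> is congruent modulo \<open>I\<close>
  to a polynomial of higher order; the component of degree \<open>N\<close> of the difference is the
  form itself, and \<open>I\<close> contains it.\<close>

lemma artinian_imp_forms_subset:
  assumes "artinian_ring (quot_alg I)"
  obtains N where "forms N \<subseteq> I"
proof -
  define L where "L n = {p :: ('n, 'k) mpoly. \<forall>m\<in>Poly_Mapping.keys p. n \<le> mon_degree m}" for n
  have "ideal (L n) poly_ring" for n
  proof (rule ideal_poly_ringI)
    show "p + q \<in> L n" if "p \<in> L n" "q \<in> L n" for p q
      using that keys_add[of p q] by (auto simp: L_def)
    show "q * p \<in> L n" if "p \<in> L n" for p q
      using that keys_mult[of q p] by (fastforce simp: L_def mon_degree_add)
  qed (simp add: L_def)
  then have "\<forall>n. ideal (residue_class I ` L n) (quot_alg I)"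
    using ideal_residue_class_image by blast
  moreover have "\<forall>n. residue_class I ` L (Suc n) \<subseteq> residue_class I ` L n"
    by (intro allI image_mono) (auto simp: L_def)
  ultimately obtain N where N: "\<And>n. n \<ge> N \<Longrightarrow> residue_class I ` L n = residue_class I ` L N"
    using assms unfolding artinian_ring_def by meson
  have "forms N \<subseteq> I"
  proof
    fix p :: "('n, 'k) mpoly" assume p: "p \<in> forms N"
    then have "p \<in> L N" by (auto simp: L_def forms_def)
    then have "residue_class I p \<in> residue_class I ` L (Suc N)" using N[of "Suc N"] by auto
    then obtain q where q: "q \<in> L (Suc N)" "p - q \<in> I" by (auto simp: residue_class_eq_iff)
    have "hom_comp N (p - q) = p"
    proof (rule poly_mapping_eqI)
      fix m
      show "Poly_Mapping.lookup (hom_comp N (p - q)) m = Poly_Mapping.lookup p m"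
      proof (cases "mon_degree m = N")
        case True
        then have "m \<notin> Poly_Mapping.keys q" using q(1) by (auto simp: L_def)
        then show ?thesis using True by (simp add: lookup_minus in_keys_iff)
      next
        case False
        then have "m \<notin> Poly_Mapping.keys p" using p by (auto simp: forms_def)
        then show ?thesis using False by (simp add: in_keys_iff)
      qed
    qed
    then show "p \<in> I" using hom_comp_mem[OF q(2), of N] by simp
  qed
  then show ?thesis using that by blast
qed

text \<open>The artinian condition bounds the degrees with nonzero component, which gives
  \<open>GREATEST\<close> in \<open>socle_degree\<close> its intended meaning.\<close>

lemma socle_degree_props:
  assumes "artinian_ring (quot_alg I)" "\<not> forms 1 \<subseteq> I"
  shows "1 \<le> socle_degree I" "forms d \<subseteq> I \<longleftrightarrow> socle_degree I < d"
proof -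
  obtain N where N: "forms N \<subseteq> I" using artinian_imp_forms_subset[OF assms(1)] .
  let ?P = "\<lambda>d. component I d \<noteq> {\<zero>\<^bsub>quot_alg I\<^esub>}"
  have bound: "d \<le> N" if "?P d" for d
    using that forms_subset_mono[OF N, of d] unfolding component_eq_zero_iff by linarith
  have 1: "?P 1" using assms(2) by (simp add: component_eq_zero_iff del: One_nat_def)
  then show "1 \<le> socle_degree I"
    unfolding socle_degree_def using bound by (rule Greatest_le_nat)
  have "?P (socle_degree I)"
    unfolding socle_degree_def using 1 bound by (rule GreatestI_nat)
  then have "\<not> forms (socle_degree I) \<subseteq> I" by (simp add: component_eq_zero_iff)
  moreover have "forms d \<subseteq> I" if "socle_degree I < d"
  proof (rule ccontr)
    assume "\<not> forms d \<subseteq> I"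
    then have "d \<le> socle_degree I"
      unfolding socle_degree_def using bound
      by (intro Greatest_le_nat[where P = ?P]) (simp_all add: component_eq_zero_iff)
    then show False using that by simp
  qed
  ultimately show "forms d \<subseteq> I \<longleftrightarrow> socle_degree I < d"
    using forms_subset_mono[of d "socle_degree I"] by linarith
qed

text \<open>Every monomial of a polynomial without constant term is divisible by a variable, so
  testing the variables suffices.\<close>

lemma socle_inter_component:
  "socle I \<inter> component I d = residue_class I ` {p \<in> forms d. \<forall>x. var x * p \<in> I}"
proof (intro subset_antisym subsetI)
  fix a assume a: "a \<in> socle I \<inter> component I d"
  then obtain p where p: "p \<in> forms d" "a = residue_class I p" by (auto simp: component_def)
  have "var x * p \<in> I" for x
  proof -
    have "0 \<notin> Poly_Mapping.keys (var x :: ('n, 'k) mpoly)"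
      using var_in_forms[of x] by (auto simp: forms_def)
    then have "Poly_Mapping.lookup (var x :: ('n, 'k) mpoly) 0 = 0" by (simp add: in_keys_iff)
    then have "residue_class I (var x) \<in> max_hom_ideal I" by (auto simp: max_hom_ideal_def)
    then have "a \<otimes>\<^bsub>quot_alg I\<^esub> residue_class I (var x) = \<zero>\<^bsub>quot_alg I\<^esub>"
      using a by (auto simp: socle_def)
    then show ?thesis
      by (simp add: p(2) residue_class_ops zero_quot_alg residue_class_eq_iff mult.commute)
  qed
  then show "a \<in> residue_class I ` {p \<in> forms d. \<forall>x. var x * p \<in> I}" using p by blast
next
  fix a assume "a \<in> residue_class I ` {p \<in> forms d. \<forall>x. var x * p \<in> I}"
  then obtain p where p: "p \<in> forms d" "\<And>x. var x * p \<in> I" "a = residue_class I p" by blast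
  have "p * q \<in> I" if q: "Poly_Mapping.lookup q 0 = 0" for q
  proof -
    have "p * Poly_Mapping.single m (Poly_Mapping.lookup q m) \<in> I" if "m \<in> Poly_Mapping.keys q" for m
    proof -
      have "mon_degree m \<noteq> 0" using that q mon_degree_eq_0D[of m] by (auto simp: in_keys_iff)
      then obtain d where "mon_degree m = Suc d" using not0_implies_Suc by blast
      then obtain x n where m: "m = Poly_Mapping.single x 1 + n" using mon_degree_SucE by blast
      have "Poly_Mapping.single m (Poly_Mapping.lookup q m)
          = Poly_Mapping.single n (Poly_Mapping.lookup q m) * var x"
        by (simp add: m var_def mult_single add.commute)
      then have "p * Poly_Mapping.single m (Poly_Mapping.lookup q m)
          = Poly_Mapping.single n (Poly_Mapping.lookup q m) * (var x * p)"
        by (simp only: ac_simps)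
      then show ?thesis using mult_mem[OF p(2)] by simp
    qed
    then have "(\<Sum>m\<in>Poly_Mapping.keys q. p * Poly_Mapping.single m (Poly_Mapping.lookup q m)) \<in> I"
      by (intro mp.subspace_sum[OF subspace_ideal])
    then show ?thesis using poly_eq_sum_singles[of q] by (simp flip: sum_distrib_left)
  qed
  then have "a \<in> socle I"
    by (auto simp: socle_def p(3) carrier_quot_alg max_hom_ideal_def residue_class_ops zero_quot_alg
        residue_class_eq_iff)
  then show "a \<in> socle I \<inter> component I d" using p by (auto simp: component_def)
qed

lemma socle_vector_eq:
  assumes "1 \<notin> I"
  shows "socle_vector I d = mp.dim (proj ` {p \<in> forms d. \<forall>x. var x * p \<in> I})"
  unfolding socle_vector_def socle_inter_component
proof (rule dim_k_eq[OF assms _ finite_monomials])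
  show "mp.subspace {p \<in> forms d. \<forall>x. var x * p \<in> I}"
    by (auto simp: mp.subspace_def zero_mem add_mem distrib_left scale_poly_mult_right forms_add
        forms_scale scale_mem)
  show "{p \<in> forms d. \<forall>x. var x * p \<in> I} \<subseteq> mp.span (monomials d)"
    using forms_subset_span_monomials by blast
qed

end

section \<open>From the algebra to its numerical data, and the theorem\<close>

lemma level_graded_ideal_if_level:
  fixes I :: "('n::finite, 'k::field) mpoly set"
  assumes "algebra_ideal I" "artinian_ring (quot_alg I)" "level I"
  shows "level_graded_ideal I (socle_degree I)" "1 \<notin> I"
proof -
  interpret graded_ideal I
    using assms(1) by (intro graded_ideal_if_homogeneous) (simp add: algebra_ideal_def)
  have I1: "I \<inter> forms 1 = {0}" using assms(1) by (simp add: algebra_ideal_def)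
  show one: "1 \<notin> I"
  proof
    fix x :: 'n
    assume "1 \<in> I"
    then have "var x \<in> I" using mult_mem[of 1 "var x"] by simp
    then have "(var x :: ('n, 'k) mpoly) = 0" using I1 var_in_forms[of x] by blast
    then show False using var_neq_0 by metis
  qed
  show "level_graded_ideal I (socle_degree I)"
  proof unfold_locales
    fix d p
    assume d: "d < socle_degree I" "p \<in> forms d" "\<And>x. var x * p \<in> I"
    let ?V = "{p \<in> forms d. \<forall>x. var x * p \<in> I}"
    have "mp.dim (proj ` ?V) = 0"
      using assms(3) d(1) socle_vector_eq[OF one, of d] by (simp add: level_def)
    moreover have "proj ` ?V \<subseteq> mp.span (proj ` monomials d)"
      using piece_subset_span[of d] by (auto simp: piece_def)
    ultimately have "proj ` ?V \<subseteq> {0}"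
      by (intro mp.subset_zero_if_dim_eq_0[of "proj ` monomials d"]) simp_all
    then show "p \<in> I" using d(2,3) proj_eq_0_iff by blast
  qed (rule I1)
qed

lemma level_hvec_hilb:
  assumes "level_graded_ideal_3 I c" and c: "1 \<le> c" "\<And>d. forms d \<subseteq> I \<longleftrightarrow> c < d"
  shows "level_hvec (graded_ideal.hilb I) c"
proof -
  interpret level_graded_ideal_3 I c by fact
  have dim: "mp.dim (forms d :: (3, 'a) mpoly set) = (2 + d) choose d" for d
    by (simp only: dim_forms card_monomials_3)
  have nz: "hilb d = 0 \<longleftrightarrow> c < d" for d by (simp add: hilb_eq_0_iff c(2))
  have h1: "hilb 1 = 3"
    using hilb_less_iff[of 1] hilb_le[of 1] no_linear_form unfolding dim by simp
  show ?thesis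
  proof
    show "hilb 0 = 1" using nz[of 0] hilb_le[of 0] unfolding dim by simp
    show "hilb 1 = 3" "1 \<le> c" by (rule h1 c)+
    show "1 \<le> hilb d" if "d \<le> c" for d using nz[of d] that by linarith
    show "hilb d = 0" if "c < d" for d using nz that by blast
    show "hilb d \<le> (2 + d) choose d" for d using hilb_le[of d] by (simp only: dim)
    show "hilb (Suc d) \<le> 3 * hilb d" for d using hilb_Suc_le_CARD[of d] by simp
    show "hilb (Suc d) \<le> hilb d" if "2 \<le> d" "hilb d \<le> 2" for d
      using hilb_Suc_le_if_le_2 that by blast
    show "3 \<le> hilb (c - 1) * hilb c" using dim_linear_forms_le[OF c(1)] unfolding dim by simp
    show "hilb 2 \<le> 4" if "2 \<le> c" "hilb (c - 1) \<le> 3" "hilb c = 2"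
      using hilb_2_le_4 that by blast
  qed
qed

theorem theorem3p7:
  fixes I :: "(3, 'k::field_char_0) mpoly set"
    and c e t :: nat and h :: "int \<Rightarrow> int" and i j m :: int
  assumes "algebra_ideal I"
    and "artinian_ring (quot_alg I)"
    and "level I"
    and "c = socle_degree I" and "e = multiplicity_alg I" and "h = h_ext I"
    and "t = inv_t I" and "i = inv_i I" and "j = inv_j I" and "m = inv_m I"
  shows "(compressed I \<longrightarrow>
            real t * real_of_int i * (real c + 3) / 6 \<le> real e \<and>
            real e \<le> real_of_int m * real_of_int j * (real c + 3) / 6) \<and>
         (h (int c - 1) = 3 \<and> h (int c) = 2 \<longrightarrow>
            real t * real_of_int i * (real c + 3) / 6 \<le> real e \<and>
            real e \<le> real_of_int m * real_of_int j * (real c + 3) / 6) \<and>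
         (h 2 \<le> 4 \<longrightarrow> real t * real_of_int i * (real c + 3) / 6 \<le> real e) \<and>
         (h (int c - 1) \<le> h (int c) + 1 \<longrightarrow>
            real e \<le> real_of_int m * real_of_int j * (real c + 3) / 6)"
proof -
  interpret level_graded_ideal I c
    unfolding assms(4) by (rule level_graded_ideal_if_level(1)[OF assms(1-3)])
  interpret level_graded_ideal_3 I c ..
  have one: "1 \<notin> I" by (rule level_graded_ideal_if_level(2)[OF assms(1-3)])
  have "\<not> forms 1 \<subseteq> I"
  proof
    assume "forms 1 \<subseteq> I"
    then have "(var 0 :: (3, 'k) mpoly) \<in> I \<inter> forms 1" using var_in_forms by blast
    then show False unfolding no_linear_form by (simp add: var_neq_0)
  qed
  note c = socle_degree_props[OF assms(2) this, folded assms(4)]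
  interpret H: level_hvec hilb c
    by (rule level_hvec_hilb[OF level_graded_ideal_3_axioms c])
  note hv = h_vector_eq_hilb[OF one]
  have hx: "h_ext I = H.hx"
    by (rule ext) (simp add: h_ext_def H.hx_def hv flip: assms(4))
  then have fx: "f_diff I = H.fx"
    by (intro ext) (simp add: f_diff_def H.fx_def)
  have inv: "i = H.i" "j = H.j" "m = H.m"
    by (simp_all add: assms(8-10) inv_i_def inv_j_def inv_m_def H.i_def H.j_def H.m_def fx flip: assms(4))
  have t: "t = H.t"
    unfolding assms(7) inv_t_def H.t_def
    by (simp only: hilb_less_iff[symmetric] dim_forms card_monomials_3)
  have e: "e = H.e"
    by (simp add: assms(5) multiplicity_alg_def H.e_def hv flip: assms(4))
  have lower: "real t * real_of_int i * (real c + 3) / 6 \<le> real e"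
    if "int H.t * H.i * (int c + 3) \<le> 6 * int H.e"
  proof -
    have "real_of_int (int H.t * H.i * (int c + 3)) \<le> real_of_int (6 * int H.e)"
      using that by (simp only: of_int_le_iff)
    then show ?thesis by (simp add: inv t e)
  qed
  have upper: "real e \<le> real_of_int m * real_of_int j * (real c + 3) / 6"
    if "6 * int H.e \<le> H.m * H.j * (int c + 3)"
  proof -
    have "real_of_int (6 * int H.e) \<le> real_of_int (H.m * H.j * (int c + 3))"
      using that by (simp only: of_int_le_iff)
    then show ?thesis by (simp add: inv e)
  qed
  have h: "h (int c - 1) = int (hilb (c - 1))" "h (int c) = int (hilb c)" "h 2 = int (hilb 2)"
    using H.hx_int[of "c - 1"] c(1) by (simp_all add: assms(6) hx of_nat_diff del: H.hx_int)
      (simp_all add: H.hx_int)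
  have i: "real t * real_of_int i * (real c + 3) / 6 \<le> real e \<and>
      real e \<le> real_of_int m * real_of_int j * (real c + 3) / 6" if "compressed I"
  proof -
    \<comment> \<open>A_{c+1} = 0 makes all of A_c socle, and levelness leaves nothing below. Hence
      a single summand, the one at l = c - d, survives in r_d.\<close>
    have s: "socle_vector I d = (if d = c then hilb c else 0)" if "d \<le> c" for d
    proof (cases "d = c")
      case True
      have "{p \<in> forms c. \<forall>x. var x * p \<in> I} = forms c"
        using forms_mult[OF var_in_forms] c(2)[of "Suc c"] by auto
      then show ?thesis
        using socle_vector_eq[OF one, of c] True by (simp add: hilb_def piece_def)
    next
      case False
      then show ?thesis using assms(3,4) that by (simp add: level_def)
    qed
    have \<rho>: "compressed_r CARD(3) c (socle_vector I) d
        = int ((2 + d) choose d) - int (hilb c * ((2 + (c - d)) choose (c - d)))" if "d \<le> c" for d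
    proof -
      have "(\<Sum>l = 0..c - d. int (num_forms 3 l) * int (socle_vector I (d + l)))
          = (\<Sum>l = 0..c - d. if l = c - d then int (num_forms 3 l) * int (hilb c) else 0)"
        using that by (intro sum.cong refl) (auto simp: s)
      also have "\<dots> = int (num_forms 3 (c - d)) * int (hilb c)" by simp
      finally show ?thesis by (simp add: compressed_r_def num_forms_def mult.commute)
    qed
    note compr = that[unfolded compressed_def Let_def, folded assms(4)]
    obtain b where b: "1 \<le> b" "b \<le> c"
      "0 \<le> compressed_r CARD(3) c (socle_vector I) b"
      "compressed_r CARD(3) c (socle_vector I) (b - 1) < 0"
      using compr[THEN conjunct1] by blast
    have hd: "int (h_vector I d) = min (int (num_forms CARD(3) d)
        - compressed_r CARD(3) c (socle_vector I) d) (int (num_forms CARD(3) d))" if "d \<le> c" for d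
      using compr[THEN conjunct2] that by blast
    have "b - 1 \<le> c" using b(2) by simp
    have hilb: "hilb d = min (hilb c * ((2 + (c - d)) choose (c - d))) ((2 + d) choose d)" if "d \<le> c" for d
    proof -
      have "int (hilb d) = min (int (hilb c * ((2 + (c - d)) choose (c - d)))) (int ((2 + d) choose d))"
        using hd[OF that] unfolding \<rho>[OF that] hv by (simp add: num_forms_def)
      then show ?thesis by (simp only: of_nat_min[symmetric] of_nat_eq_iff)
    qed
    have b_le: "hilb c * ((2 + (c - b)) choose (c - b)) \<le> (2 + b) choose b"
      using b(3) unfolding \<rho>[OF b(2)] by linarith
    have b_less: "(2 + (b - 1)) choose (b - 1) < hilb c * ((2 + (c - (b - 1))) choose (c - (b - 1)))"
      using b(4) unfolding \<rho>[OF \<open>b - 1 \<le> c\<close>] by linarith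
    note bounds = H.bounds_if_compressed[OF b(1,2) hilb b_le b_less]
    show ?thesis using lower[OF bounds(1)] upper[OF bounds(2)] by blast
  qed
  have iii: "real t * real_of_int i * (real c + 3) / 6 \<le> real e" if "h 2 \<le> 4"
    using that by (intro lower H.lower_bound_if_H_2_le_4) (simp add: h)
  have iv: "real e \<le> real_of_int m * real_of_int j * (real c + 3) / 6" if "h (int c - 1) \<le> h (int c) + 1"
    using that by (intro upper H.upper_bound_if_last_le) (simp add: h)
  \<comment> \<open>As h_0 = 1, the value h_{c-1} = 3 excludes c = 1, so the count of quadrics
    applies.\<close>
  have ii: "h 2 \<le> 4" if "h (int c - 1) = 3" "h (int c) = 2"
  proof -
    have *: "hilb (c - 1) = 3" "hilb c = 2" using that unfolding h by simp_all
    have "c \<noteq> 1"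
    proof
      assume "c = 1"
      then show False using *(1) H.H_0 by (simp only: diff_self_eq_0)
    qed
    then have "2 \<le> c" using c(1) by linarith
    then have "hilb 2 \<le> 4" by (rule hilb_2_le_4) (simp_all only: * order_refl)
    then show ?thesis unfolding h by simp
  qed
  have ii_bounds: "real t * real_of_int i * (real c + 3) / 6 \<le> real e \<and>
      real e \<le> real_of_int m * real_of_int j * (real c + 3) / 6" if "h (int c - 1) = 3 \<and> h (int c) = 2"
  proof (rule conjI)
    have last: "h (int c - 1) = 3" "h (int c) = 2" using that by auto
    show "real t * real_of_int i * (real c + 3) / 6 \<le> real e" by (rule iii[OF ii[OF last]])
    show "real e \<le> real_of_int m * real_of_int j * (real c + 3) / 6" by (rule iv) (simp only: last)
  qed
  show ?thesis
    by (rule conjI[OF impI conjI[OF impI conjI[OF impI impI]]]) (rule i ii_bounds iii iv, assumption)+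
qed

end
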